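(* Let $f:\mathbb D\subset\mathbb R^n\to\mathbb R$ be an $a$-self-concordant function, $\mathbb D$ open and convex. Assume that there is an initial point $\mathbf x_0\in\mathbb D$ such that $f''(\mathbf x_0)$ is nonsingular. Let $\{\mathbf x_k\}$ be the sequence generated by the two-step Newton method $$\mathbf y_k=\mathbf x_k-f''(\mathbf x_k)^{-1}f'(\mathbf x_k),\qquad \mathbf x_{k+1}=\mathbf y_k-f''(\mathbf x_k)^{-1}f'(\mathbf y_k),\qquad k=0,1,2,\dots,$$ for solving $f'(\mathbf x)=\mathbf 0$ with initial point $\mathbf x_0$. If $\beta:=\|f''(\mathbf x_0)^{-1}f'(\mathbf x_0)\|_{\mathbf x_0}\le3-2\sqrt2$, then $\{\mathbf x_k\}$ is well-defined and converges Q-superquadratically to a point $\mathbf x^*$ which is the minimizer of $f$ in $\overline{\mathbf B_{t^*}(\mathbf x_0)}$, and this minimizer $\mathbf x^*$ is unique in $\overline{\mathbf B_r(\mathbf x_0)}$, where $t^*\le r<t^{**}$ and $$t^*=\frac{1+\beta-\sqrt{(1+\beta)^2-8\beta}}{4},\qquad t^{**}=\frac{1+\beta+\sqrt{(1+\beta)^2-8\beta}}{4}.$$ Moreover, if $0<\beta<3-\sqrt[3]{2}-\sqrt[3]{4}$, then the order of convergence is at least cubic (Q-cubic) and $$\|\mathbf x^*-\mathbf x_{k+1}\|_{\mathbf x_0}\le\frac{qH_*^2}{2}\cdot\|\mathbf x^*-\mathbf x_k\|_{\mathbf x_0}^3,\qquad k\ge0,$$ where $$H_*=-\frac{32}{\sqrt{(1+\beta)^2-8\beta}\cdot\left(3-\beta+\sqrt{(1+\beta)^2-8\beta}\right)^2}$$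 and $$q=\frac{\sqrt{(1+\beta)^2-8\beta}\cdot(3-\beta+\sqrt{(1+\beta)^2-8\beta})^2+4(1+\beta-\sqrt{(1+\beta)^2-8\beta})}{\sqrt{(1+\beta)^2-8\beta}\cdot(3-\beta+\sqrt{(1+\beta)^2-8\beta})^2-4(1+\beta-\sqrt{(1+\beta)^2-8\beta})}.$$
   Context: Let $a>0$ be a constant. A strictly convex, three times continuously differentiable function $f:\mathbb D\subset\mathbb R^n\to\mathbb R$ ($\mathbb D$ open and convex) is $a$-self-concordant if $$|f'''(\mathbf x)[\mathbf u,\mathbf u,\mathbf u]|\le2a^{-1/2}\left(f''(\mathbf x)[\mathbf u,\mathbf u]\right)^{3/2},\qquad \mathbf x\in\mathbb D,\ \mathbf u\in\mathbb R^n.$$ For $\mathbf x\in\mathbb D$ set $\langle\mathbf u_1,\mathbf u_2\rangle_{\mathbf x}:=a^{-1}\langle f''(\mathbf x)\mathbf u_1,\mathbf u_2\rangle$ and $\|\mathbf u\|_{\mathbf x}:=\sqrt{\langle\mathbf u,\mathbf u\rangle_{\mathbf x}}$. For $r>0$, $\mathbf B_r(\mathbf x):=\{\mathbf y\in\mathbb R^n:\|\mathbf y-\mathbf x\|_{\mathbf x}<r\}$ and $\overline{\mathbf B_r(\mathbf x)}:=\{\mathbf y\in\mathbb R^n:\|\mathbf y-\mathbf x\|_{\mathbf x}\le r\}$. It is assumed that $\mathbf B_{r_0}(\mathbf x_0)\subset\mathbb D$ with $r_0=1-\frac1{\sqrt2}$. In the norm $\|\cdot\|=\|\cdot\|_{\mathbf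 x_0}$: $\{\mathbf x_k\}$ converges to $\mathbf x^*$ Q-superquadratically if for any $c>0$ there is $N_c\ge0$ with $\|\mathbf x_{k+1}-\mathbf x^*\|\le c\|\mathbf x_k-\mathbf x^*\|^2$ for all $k\ge N_c$; it converges Q-cubically if there are constants $c\ge0$, $N_c\ge0$ with $\|\mathbf x_{k+1}-\mathbf x^*\|\le c\|\mathbf x_k-\mathbf x^*\|^3$ for all $k\ge N_c$. *)

theory Defs
  imports "HOL-Analysis.Analysis"
begin

text \<open>
  Functions on an open set \<open>D\<close> are represented by total functions on \<open>real ^ 'n\<close>. Since \<open>D\<close> is
  open, the derivatives below at a point of \<open>D\<close> depend only on the values on \<open>D\<close>; at a point
  where \<open>f\<close> is not differentiable, \<open>grad f\<close> and \<open>hess f\<close> have unspecified values.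
\<close>

definition grad :: "(real ^ 'n \<Rightarrow> real) \<Rightarrow> real ^ 'n \<Rightarrow> real ^ 'n" where
  "grad f x = (THE g. GDERIV f x :> g)"

definition hess :: "(real ^ 'n \<Rightarrow> real) \<Rightarrow> real ^ 'n \<Rightarrow> real ^ 'n ^ 'n" where
  "hess f x = matrix (frechet_derivative (grad f) (at x))"

text \<open>
  \<open>third_deriv f x u\<close> is the matrix of the bilinear form \<open>f'''(x)[u, \<cdot>, \<cdot>]\<close>.
\<close>

definition third_deriv :: "(real ^ 'n \<Rightarrow> real) \<Rightarrow> real ^ 'n \<Rightarrow> real ^ 'n \<Rightarrow> real ^ 'n ^ 'n" where
  "third_deriv f x = frechet_derivative (hess f) (at x)"

definition C3_on :: "(real ^ 'n) set \<Rightarrow> (real ^ 'n \<Rightarrow> real) \<Rightarrow> bool" where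
  "C3_on D f \<longleftrightarrow>
     (\<forall>x\<in>D. f differentiable (at x)) \<and>
     (\<forall>x\<in>D. grad f differentiable (at x)) \<and>
     (\<forall>x\<in>D. hess f differentiable (at x)) \<and>
     (\<forall>u. continuous_on D (\<lambda>x. third_deriv f x u))"

definition strictly_convex_on :: "(real ^ 'n) set \<Rightarrow> (real ^ 'n \<Rightarrow> real) \<Rightarrow> bool" where
  "strictly_convex_on D f \<longleftrightarrow> convex D \<and>
     (\<forall>x\<in>D. \<forall>y\<in>D. \<forall>t. x \<noteq> y \<and> 0 < t \<and> t < 1 \<longrightarrow>
        f ((1 - t) *\<^sub>R x + t *\<^sub>R y) < (1 - t) * f x + t * f y)"

definition self_concordant_on :: "real \<Rightarrow> (real ^ 'n) set \<Rightarrow> (real ^ 'n \<Rightarrow> real) \<Rightarrow> bool" where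
  "self_concordant_on a D f \<longleftrightarrow> strictly_convex_on D f \<and> C3_on D f \<and>
     (\<forall>x\<in>D. \<forall>u. \<bar>(third_deriv f x u *v u) \<bullet> u\<bar>
        \<le> 2 * a powr (- 1 / 2) * ((hess f x *v u) \<bullet> u) powr (3 / 2))"

definition local_inner ::
  "real \<Rightarrow> (real ^ 'n \<Rightarrow> real) \<Rightarrow> real ^ 'n \<Rightarrow> real ^ 'n \<Rightarrow> real ^ 'n \<Rightarrow> real" where
  "local_inner a f x u v = inverse a * ((hess f x *v u) \<bullet> v)"

definition local_norm :: "real \<Rightarrow> (real ^ 'n \<Rightarrow> real) \<Rightarrow> real ^ 'n \<Rightarrow> real ^ 'n \<Rightarrow> real" where
  "local_norm a f x u = sqrt (local_inner a f x u u)"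

definition local_ball :: "real \<Rightarrow> (real ^ 'n \<Rightarrow> real) \<Rightarrow> real ^ 'n \<Rightarrow> real \<Rightarrow> (real ^ 'n) set" where
  "local_ball a f x r = {y. local_norm a f x (y - x) < r}"

definition local_cball :: "real \<Rightarrow> (real ^ 'n \<Rightarrow> real) \<Rightarrow> real ^ 'n \<Rightarrow> real \<Rightarrow> (real ^ 'n) set" where
  "local_cball a f x r = {y. local_norm a f x (y - x) \<le> r}"

text \<open>
  Convergence of a sequence \<open>X\<close> to \<open>l\<close>, and its order, with respect to a norm \<open>N\<close>. Convergence
  itself has to be required, as the order estimates alone do not imply it.
\<close>

definition converges_Q_superquadratically ::
  "(real ^ 'n \<Rightarrow> real) \<Rightarrow> (nat \<Rightarrow> real ^ 'n) \<Rightarrow> real ^ 'n \<Rightarrow> bool" where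
  "converges_Q_superquadratically N X l \<longleftrightarrow> (\<lambda>k. N (X k - l)) \<longlonglongrightarrow> 0 \<and>
     (\<forall>c>0. \<exists>K. \<forall>k\<ge>K. N (X (Suc k) - l) \<le> c * N (X k - l) ^ 2)"

definition converges_Q_cubically ::
  "(real ^ 'n \<Rightarrow> real) \<Rightarrow> (nat \<Rightarrow> real ^ 'n) \<Rightarrow> real ^ 'n \<Rightarrow> bool" where
  "converges_Q_cubically N X l \<longleftrightarrow> (\<lambda>k. N (X k - l)) \<longlonglongrightarrow> 0 \<and>
     (\<exists>c\<ge>0. \<exists>K. \<forall>k\<ge>K. N (X (Suc k) - l) \<le> c * N (X k - l) ^ 3)"

definition discr_root :: "real \<Rightarrow> real" where
  "discr_root \<beta> = sqrt ((1 + \<beta>) ^ 2 - 8 * \<beta>)"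

definition t_star :: "real \<Rightarrow> real" where
  "t_star \<beta> = (1 + \<beta> - discr_root \<beta>) / 4"

definition t_star_star :: "real \<Rightarrow> real" where
  "t_star_star \<beta> = (1 + \<beta> + discr_root \<beta>) / 4"

definition H_star :: "real \<Rightarrow> real" where
  "H_star \<beta> = - (32 / (discr_root \<beta> * (3 - \<beta> + discr_root \<beta>) ^ 2))"

definition q_const :: "real \<Rightarrow> real" where
  "q_const \<beta> =
     (discr_root \<beta> * (3 - \<beta> + discr_root \<beta>) ^ 2 + 4 * (1 + \<beta> - discr_root \<beta>)) /
     (discr_root \<beta> * (3 - \<beta> + discr_root \<beta>) ^ 2 - 4 * (1 + \<beta> - discr_root \<beta>))"

end

(*
  Write N for the local norm at x0. Applied along segments, the diagonal bound on f''' gives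
  (1 - r)^2 f''(x0) <= f''(x) <= (1 - r)^-2 f''(x0) for r = N (x - x0) < 1. For a symmetric
  trilinear form the diagonal bound extends to |T(u,v,w)| <= |u| |v| |w|, so the second
  derivative of f' in the norm N is at most h''(r) = 2 / (1 - r)^3, where
  h(t) = beta - t + t^2 / (1 - t) has the zeros tau = t_star and t_star_star. Hence the iteration is majorized by
  the scalar two-step Newton iteration for h started at 0, which increases to a limit <= tau.

  In a ball of radius R < 1 - 1 / sqrt 2, put L = 2 / (1 - R)^3, kappa = 2 - 1 / (1 - R)^2 and
  H = L / kappa. With e = N (xs - x_k) and eta = N (xs - y_k), Taylor expansion gives
  eta <= H e^2 / 2 and N (xs - x_{k+1}) <= H eta (e + eta / 2) <= H^2 / 2 (1 + H e / 4) e^3. For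
  R = tau we have H = -H_star and e <= 2 tau, so 1 + H e / 4 <= 1 + z <= (1 + z) / (1 - z) = q with
  z = H tau / 2, and z < 1 is equivalent to (1 - tau)^3 > 1/2, that is, to the bound on beta.
*)
theory Submission
  imports Defs
begin

section \<open>Symmetry of second derivatives\<close>

text \<open>The trilinear bound must hold with constant 1: only then is \<open>h\<close> itself the
  majorant, whereas plain polarization of the diagonal bound loses a factor. The sharp constant
  comes from averaging the cubic form over three unit vectors in a plane. That argument requires a
  fully symmetric third derivative, hence the opening lemmas on Frechet derivatives. Away from
  \<open>x0\<close> convexity yields only a semidefinite Hessian, so the local norms are handled as
  seminorms. The extreme case \<beta> = 3 - 2 sqrt 2 shapes the end of the proof. There \<tau> = 1 -
  1 / sqrt 2 and kappa vanishes at \<tau>, so the majorant by itself gives neither that the limit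
  lies in \<open>D\<close> nor a finite H. A separate estimate puts the limit strictly inside the
  ball. A radius R between its distance from \<open>x0\<close> and 1 - 1 / sqrt 2 then yields
  eventual cubic decay for every admissible \<beta>, and superquadratic convergence follows from it.
  The choice R = \<tau> is kept for the explicit constants.\<close>

lemma second_difference_bound:
  fixes f :: "'a::real_inner \<Rightarrow> real"
  assumes f: "\<And>y. y \<in> ball x d \<Longrightarrow> (f has_derivative (\<lambda>h. g y \<bullet> h)) (at y)"
    and A: "linear A"
    and g: "\<And>h. norm h < d \<Longrightarrow> norm (g (x + h) - g x - A h) \<le> e * norm h"
    and s: "0 < s" "s * (norm u + norm v) < d" and e: "0 \<le> e"
  shows "\<bar>f (x + s *\<^sub>R u + s *\<^sub>R v) - f (x + s *\<^sub>R u) - f (x + s *\<^sub>R v) + f x - s\<^sup>2 * (A v \<bullet> u)\<bar>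
    \<le> 2 * e * s\<^sup>2 * (norm u + norm v)\<^sup>2"
proof -
  define K where "K = norm u + norm v"
  define \<phi> where "\<phi> \<sigma> = f (x + \<sigma> *\<^sub>R u + s *\<^sub>R v) - f (x + \<sigma> *\<^sub>R u)" for \<sigma>
  have near: "norm (\<sigma> *\<^sub>R u + s *\<^sub>R v) \<le> s * K" "norm (\<sigma> *\<^sub>R u) \<le> s * K"
    if "0 \<le> \<sigma>" "\<sigma> \<le> s" for \<sigma>
  proof -
    have "norm (\<sigma> *\<^sub>R u) \<le> s * norm u"
      using that by (simp add: mult_right_mono)
    moreover have "norm (s *\<^sub>R v) = s * norm v" using s by simp
    ultimately show "norm (\<sigma> *\<^sub>R u + s *\<^sub>R v) \<le> s * K"
      unfolding K_def distrib_left using norm_triangle_ineq[of "\<sigma> *\<^sub>R u" "s *\<^sub>R v"] by linarith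
    show "norm (\<sigma> *\<^sub>R u) \<le> s * K"
      unfolding K_def distrib_left using \<open>norm (\<sigma> *\<^sub>R u) \<le> s * norm u\<close> s by (simp add: add_increasing2)
  qed
  have lt: "s * K < d" using s K_def by simp
  have in_ball: "x + p \<in> ball x d" if "norm p < d" for p
    using that by (simp add: dist_norm)
  have \<phi>': "(\<phi> has_real_derivative (g (x + \<sigma> *\<^sub>R u + s *\<^sub>R v) - g (x + \<sigma> *\<^sub>R u)) \<bullet> u) (at \<sigma>)"
    if "0 \<le> \<sigma>" "\<sigma> \<le> s" for \<sigma>
  proof -
    have "x + \<sigma> *\<^sub>R u + s *\<^sub>R v \<in> ball x d" "x + \<sigma> *\<^sub>R u \<in> ball x d"
      using near[OF that] lt in_ball[of "\<sigma> *\<^sub>R u + s *\<^sub>R v"] in_ball[of "\<sigma> *\<^sub>R u"]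
      unfolding add.assoc by linarith+
    then have 1: "(f has_derivative (\<lambda>h. g (x + \<sigma> *\<^sub>R u + s *\<^sub>R v) \<bullet> h)) (at (x + \<sigma> *\<^sub>R u + s *\<^sub>R v))"
      and 2: "(f has_derivative (\<lambda>h. g (x + \<sigma> *\<^sub>R u) \<bullet> h)) (at (x + \<sigma> *\<^sub>R u))"
      using f by blast+
    have 3: "((\<lambda>\<sigma>. x + \<sigma> *\<^sub>R u + s *\<^sub>R v) has_derivative (\<lambda>h. h *\<^sub>R u)) (at \<sigma>)"
      "((\<lambda>\<sigma>. x + \<sigma> *\<^sub>R u) has_derivative (\<lambda>h. h *\<^sub>R u)) (at \<sigma>)"
      by (auto intro!: derivative_eq_intros)
    have "(\<phi> has_derivative (\<lambda>h. g (x + \<sigma> *\<^sub>R u + s *\<^sub>R v) \<bullet> (h *\<^sub>R u) - g (x + \<sigma> *\<^sub>R u) \<bullet> (h *\<^sub>R u))) (at \<sigma>)"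
      unfolding \<phi>_def
      by (rule has_derivative_diff has_derivative_compose[OF 3(1) 1] has_derivative_compose[OF 3(2) 2])+
    then show ?thesis
      unfolding has_field_derivative_def
      by (rule has_derivative_eq_rhs) (simp add: fun_eq_iff inner_diff_left algebra_simps)
  qed
  \<comment> \<open>The mean value theorem is used only in the direction \<open>u\<close>. The
    increment along \<open>v\<close> is read off from the differentiability of \<open>g\<close> at
    \<open>x\<close>, where the terms \<open>A (\<xi> *\<^sub>R u)\<close> cancel and the unknown
    \<open>\<xi>\<close> drops out.\<close>
  obtain \<xi> where \<xi>: "0 < \<xi>" "\<xi> < s"
    and eq: "\<phi> s - \<phi> 0 = (s - 0) * ((g (x + \<xi> *\<^sub>R u + s *\<^sub>R v) - g (x + \<xi> *\<^sub>R u)) \<bullet> u)"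
    using MVT2[OF s(1), of \<phi> "\<lambda>\<sigma>. (g (x + \<sigma> *\<^sub>R u + s *\<^sub>R v) - g (x + \<sigma> *\<^sub>R u)) \<bullet> u"] \<phi>' by auto
  let ?p = "\<xi> *\<^sub>R u + s *\<^sub>R v" and ?q = "\<xi> *\<^sub>R u"
  have n: "norm ?p \<le> s * K" "norm ?q \<le> s * K" using near \<xi> by auto
  have "norm (g (x + ?p) - g x - A ?p) \<le> e * (s * K)" "norm (g (x + ?q) - g x - A ?q) \<le> e * (s * K)"
    using g[of ?p] g[of ?q] n lt e by (meson mult_left_mono order_le_less_trans order_trans)+
  then have "norm ((g (x + ?p) - g x - A ?p) - (g (x + ?q) - g x - A ?q)) \<le> 2 * e * (s * K)"
    using norm_triangle_ineq4[of "g (x + ?p) - g x - A ?p" "g (x + ?q) - g x - A ?q"] by linarith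
  moreover have "(g (x + ?p) - g x - A ?p) - (g (x + ?q) - g x - A ?q) = g (x + ?p) - g (x + ?q) - s *\<^sub>R A v"
    using A by (simp add: linear_add linear_scale)
  ultimately have "norm (g (x + ?p) - g (x + ?q) - s *\<^sub>R A v) * norm u \<le> 2 * e * (s * K) * norm u"
    by (simp add: mult_right_mono)
  also have "\<dots> \<le> 2 * e * (s * K) * K"
    using e s by (intro mult_left_mono) (auto simp: K_def)
  finally have "\<bar>(g (x + ?p) - g (x + ?q) - s *\<^sub>R A v) \<bullet> u\<bar> \<le> 2 * e * (s * K) * K"
    using Cauchy_Schwarz_ineq2 order_trans by blast
  then have "s * \<bar>(g (x + ?p) - g (x + ?q) - s *\<^sub>R A v) \<bullet> u\<bar> \<le> s * (2 * e * (s * K) * K)"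
    using s by (simp add: mult_left_mono)
  then have "\<bar>s * ((g (x + ?p) - g (x + ?q) - s *\<^sub>R A v) \<bullet> u)\<bar> \<le> s * (2 * e * (s * K) * K)"
    using s by (simp add: abs_mult)
  moreover have "s * ((g (x + ?p) - g (x + ?q) - s *\<^sub>R A v) \<bullet> u) = \<phi> s - \<phi> 0 - s\<^sup>2 * (A v \<bullet> u)"
    unfolding eq by (simp add: add.assoc inner_diff_left right_diff_distrib power2_eq_square)
  ultimately show ?thesis unfolding \<phi>_def K_def by (simp add: power2_eq_square algebra_simps)
qed

text \<open>The second difference of \<open>f\<close> is unchanged when \<open>u\<close> and
  \<open>v\<close> are swapped, and divided by \<open>s^2\<close> it approximates both sides with
  arbitrarily small error.\<close>

lemma second_derivative_symmetric:
  fixes f :: "'a::real_inner \<Rightarrow> real"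
  assumes "open D" "x \<in> D"
    and f: "\<And>y. y \<in> D \<Longrightarrow> (f has_derivative (\<lambda>h. g y \<bullet> h)) (at y)"
    and g: "(g has_derivative A) (at x)"
  shows "A u \<bullet> v = A v \<bullet> u"
proof -
  define K where "K = norm u + norm v"
  have A: "linear A" using g has_derivative_linear by blast
  have "\<bar>A u \<bullet> v - A v \<bullet> u\<bar> \<le> 4 * e * K\<^sup>2" if e: "e > 0" for e
  proof -
    obtain d1 where d1: "d1 > 0" "\<And>y. norm (y - x) < d1 \<Longrightarrow> norm (g y - g x - A (y - x)) \<le> e * norm (y - x)"
      using g e unfolding has_derivative_at_alt by blast
    obtain d2 where d2: "d2 > 0" "ball x d2 \<subseteq> D"
      using \<open>open D\<close> \<open>x \<in> D\<close> openE by blast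
    define d where "d = min d1 d2"
    have d: "d > 0" using d1 d2 d_def by auto
    \<comment> \<open>\<open>K + 1\<close> keeps the step positive also for
      \<open>u = v = 0\<close>, where division by \<open>K\<close> would return 0.\<close>
    define s where "s = d / (2 * (K + 1))"
    have K: "K \<ge> 0" by (simp add: K_def)
    have s: "s > 0" using d K by (simp add: s_def)
    have "s * K \<le> s * (K + 1)" using s by simp
    also have "\<dots> = d / 2" using K by (simp add: s_def divide_simps)
    also have "\<dots> < d" using d by simp
    finally have sK: "s * K < d" .
    have gd: "norm (g (x + h) - g x - A h) \<le> e * norm h" if "norm h < d" for h
      using d1(2)[of "x + h"] that d_def by simp
    have fd: "(f has_derivative (\<lambda>h. g y \<bullet> h)) (at y)" if "y \<in> ball x d" for y
      using f d2 that d_def by (meson min.cobounded2 subsetD subset_ball)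
    let ?\<Delta> = "f (x + s *\<^sub>R u + s *\<^sub>R v) - f (x + s *\<^sub>R u) - f (x + s *\<^sub>R v) + f x"
    have "\<bar>?\<Delta> - s\<^sup>2 * (A v \<bullet> u)\<bar> \<le> 2 * e * s\<^sup>2 * K\<^sup>2"
      using second_difference_bound[where d = d, OF fd A gd s(1), of u v] sK e K_def by simp
    moreover have "\<bar>?\<Delta> - s\<^sup>2 * (A u \<bullet> v)\<bar> \<le> 2 * e * s\<^sup>2 * K\<^sup>2"
    proof -
      have "x + s *\<^sub>R v + s *\<^sub>R u = x + s *\<^sub>R u + s *\<^sub>R v" "norm v + norm u = K"
        by (simp_all add: K_def)
      then have "\<bar>f (x + s *\<^sub>R u + s *\<^sub>R v) - f (x + s *\<^sub>R v) - f (x + s *\<^sub>R u) + f x - s\<^sup>2 * (A u \<bullet> v)\<bar>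
          \<le> 2 * e * s\<^sup>2 * K\<^sup>2"
        using second_difference_bound[where d = d, OF fd A gd s(1), of v u] sK e
        unfolding \<open>norm v + norm u = K\<close> \<open>_ = x + s *\<^sub>R u + s *\<^sub>R v\<close> by simp
      then show ?thesis by (simp add: diff_right_commute)
    qed
    ultimately have "\<bar>s\<^sup>2 * (A u \<bullet> v) - s\<^sup>2 * (A v \<bullet> u)\<bar> \<le> 4 * e * s\<^sup>2 * K\<^sup>2" by linarith
    moreover have "s\<^sup>2 * \<bar>A u \<bullet> v - A v \<bullet> u\<bar> = \<bar>s\<^sup>2 * (A u \<bullet> v) - s\<^sup>2 * (A v \<bullet> u)\<bar>"
      by (simp add: abs_mult flip: right_diff_distrib)
    ultimately have "s\<^sup>2 * \<bar>A u \<bullet> v - A v \<bullet> u\<bar> \<le> s\<^sup>2 * (4 * e * K\<^sup>2)"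
      by (simp add: mult_ac)
    then show ?thesis using s by simp
  qed
  note bound = this
  have "\<bar>A u \<bullet> v - A v \<bullet> u\<bar> \<le> 0 + r" if "r > 0" for r
  proof -
    have K1: "K\<^sup>2 + 1 > 0" by (simp add: add_nonneg_pos)
    have "4 * (r / (4 * (K\<^sup>2 + 1))) * K\<^sup>2 \<le> r"
      using K1 that by (simp add: field_simps)
    then show ?thesis using bound[of "r / (4 * (K\<^sup>2 + 1))"] K1 that by simp
  qed
  then show ?thesis using field_le_epsilon by (metis abs_le_zero_iff eq_iff_diff_eq_0)
qed

text \<open>The weights \<open>(4 C\<^sub>j\<^sup>2 - 1)\<^sup>2 / 9\<close> are those of the Fejer kernel at the three cube roots of \<open>c + i s\<close>.\<close>

lemma three_node_identity:
  fixes C S q a b c d :: real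
  assumes "C\<^sup>2 + S\<^sup>2 = 1" and "q\<^sup>2 = 3"
  defines "P \<equiv> \<lambda>X Y. a * X ^ 3 + 3 * b * X\<^sup>2 * Y + 3 * c * X * Y\<^sup>2 + d * Y ^ 3"
    and "W \<equiv> \<lambda>X. (4 * X\<^sup>2 - 1)\<^sup>2 / 9"
  defines "C1 \<equiv> (- C - q * S) / 2" and "S1 \<equiv> (q * C - S) / 2"
    and "C2 \<equiv> (- C + q * S) / 2" and "S2 \<equiv> (- q * C - S) / 2"
  shows "W C * P C S + W C1 * P C1 S1 + W C2 * P C2 S2 = a * (4 * C ^ 3 - 3 * C) + b * (3 * S - 4 * S ^ 3)"
    and "W C + W C1 + W C2 = 1"
    and "C1\<^sup>2 + S1\<^sup>2 = 1" "C2\<^sup>2 + S2\<^sup>2 = 1"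
proof -
  \<comment> \<open>Halved coordinates clear the denominators of the rotated nodes, so that all
    claims become polynomial consequences of \<open>xy\<close> and \<open>q^2 = 3\<close>.\<close>
  define x y where "x = C / 2" and "y = S / 2"
  have xy: "4 * x\<^sup>2 + 4 * y\<^sup>2 = 1" using assms(1) by (simp add: x_def y_def power_divide)
  have eqs: "C = 2 * x" "S = 2 * y" "C1 = - x - q * y" "S1 = q * x - y" "C2 = - x + q * y" "S2 = - q * x - y"
    unfolding C1_def S1_def C2_def S2_def x_def y_def by (simp_all add: field_simps)
  show "C1\<^sup>2 + S1\<^sup>2 = 1" "C2\<^sup>2 + S2\<^sup>2 = 1"
    unfolding eqs using xy assms(2) by algebra+
  have "(4 * (2 * x)\<^sup>2 - 1)\<^sup>2 + (4 * (- x - q * y)\<^sup>2 - 1)\<^sup>2 + (4 * (- x + q * y)\<^sup>2 - 1)\<^sup>2 = 9"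
    using xy assms(2) by algebra
  then show "W C + W C1 + W C2 = 1"
    unfolding W_def eqs by simp
  have "(4 * (2 * x)\<^sup>2 - 1)\<^sup>2 * P (2 * x) (2 * y) + (4 * (- x - q * y)\<^sup>2 - 1)\<^sup>2 * P (- x - q * y) (q * x - y)
     + (4 * (- x + q * y)\<^sup>2 - 1)\<^sup>2 * P (- x + q * y) (- q * x - y)
     = 9 * (a * (4 * (2 * x) ^ 3 - 3 * (2 * x)) + b * (3 * (2 * y) - 4 * (2 * y) ^ 3))"
    unfolding P_def using xy assms(2) by algebra
  then show "W C * P C S + W C1 * P C1 S1 + W C2 * P C2 S2 = a * (4 * C ^ 3 - 3 * C) + b * (3 * S - 4 * S ^ 3)"
    unfolding W_def eqs by simp
qed

section \<open>Symmetric trilinear forms\<close>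

text \<open>Definiteness is left out on purpose: at points other than \<open>x0\<close> the Hessian
  of a strictly convex function may degenerate.\<close>

locale semi_inner =
  fixes Q :: "'a::real_vector \<Rightarrow> 'a \<Rightarrow> real"
  assumes lin: "linear (Q u)" and sym: "Q u v = Q v u" and nonneg: "0 \<le> Q u u"
begin

definition N :: "'a \<Rightarrow> real" where "N u = sqrt (Q u u)"

lemma right: "Q u (v + w) = Q u v + Q u w" "Q u (v - w) = Q u v - Q u w"
  "Q u (c *\<^sub>R v) = c * Q u v" "Q u (- v) = - Q u v" "Q u 0 = 0"
  using lin[of u] by (simp_all add: linear_add linear_diff linear_scale linear_neg linear_0)

lemma left: "Q (v + w) u = Q v u + Q w u" "Q (v - w) u = Q v u - Q w u"
  "Q (c *\<^sub>R v) u = c * Q v u" "Q (- v) u = - Q v u" "Q 0 u = 0"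
  by (simp_all add: sym[of _ u] right)

lemma N_nonneg [simp]: "0 \<le> N u" by (simp add: N_def nonneg)

lemma N_sq: "(N u)\<^sup>2 = Q u u" by (simp add: N_def nonneg)

lemma N_scale: "N (c *\<^sub>R u) = \<bar>c\<bar> * N u"
  by (simp add: N_def left right real_sqrt_mult flip: mult.assoc)

lemma N_minus [simp]: "N (- u) = N u" by (simp add: N_def left right)

lemma N_zero [simp]: "N 0 = 0" by (simp add: N_def left)

lemma N_commute: "N (u - v) = N (v - u)"
  using N_minus[of "u - v"] by simp

lemma cauchy_schwarz: "\<bar>Q u v\<bar> \<le> N u * N v"
proof -
  have q: "0 \<le> Q u u + 2 * t * Q u v + t\<^sup>2 * Q v v" for t
    using nonneg[of "u + t *\<^sub>R v"] by (simp add: left right sym[of v u] algebra_simps power2_eq_square)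
  have "(Q u v)\<^sup>2 \<le> Q u u * Q v v"
  proof (cases "Q v v = 0")
    case True
    \<comment> \<open>For \<open>Q v v = 0\<close> the nonnegative quadratic \<open>q\<close> is
      affine in \<open>t\<close>; a nonzero slope would let it reach the value -1.\<close>
    have "Q u v = 0"
    proof (rule ccontr)
      assume "Q u v \<noteq> 0"
      then have "Q u u + 2 * (- (Q u u + 1) / (2 * Q u v)) * Q u v = - 1" by (simp add: field_simps)
      then show False using q[of "- (Q u u + 1) / (2 * Q u v)"] True by simp
    qed
    then show ?thesis using True by simp
  next
    case False
    then have pos: "Q v v > 0" using nonneg[of v] by simp
    have "0 \<le> Q u u - (Q u v)\<^sup>2 / Q v v"
      using q[of "- Q u v / Q v v"] pos by (simp add: power2_eq_square field_simps)
    then show ?thesis using pos by (simp add: field_simps)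
  qed
  then have "(\<bar>Q u v\<bar>)\<^sup>2 \<le> (N u * N v)\<^sup>2" by (simp add: power_mult_distrib N_sq)
  then show ?thesis by (rule power2_le_imp_le) simp
qed

lemma normalized: "0 < N u \<Longrightarrow> Q ((1 / N u) *\<^sub>R u) ((1 / N u) *\<^sub>R u) = 1"
  using N_sq[of u] by (auto simp: left right power2_eq_square)

lemma N_triangle: "N (u + v) \<le> N u + N v"
proof (rule power2_le_imp_le)
  have "(N (u + v))\<^sup>2 = (N u)\<^sup>2 + 2 * Q u v + (N v)\<^sup>2"
    by (simp add: N_sq left right sym[of v u])
  also have "\<dots> \<le> (N u + N v)\<^sup>2"
    using cauchy_schwarz[of u v] by (simp add: power2_sum)
  finally show "(N (u + v))\<^sup>2 \<le> (N u + N v)\<^sup>2" .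
qed simp

lemma N_triangle_diff: "N (u - w) \<le> N (u - v) + N (v - w)"
  using N_triangle[of "u - v" "v - w"] by simp

end

locale symmetric_trilinear =
  fixes T :: "'a::real_vector \<Rightarrow> 'a \<Rightarrow> 'a \<Rightarrow> real"
  assumes lin3: "linear (T u v)" and s12: "T u v w = T v u w" and s23: "T u v w = T u w v"
begin

lemma T3: "T u v (w + w') = T u v w + T u v w'" "T u v (w - w') = T u v w - T u v w'"
  "T u v (c *\<^sub>R w) = c * T u v w" "T u v (- w) = - T u v w"  "T u v 0 = 0"
  using lin3[of u v] by (simp_all add: linear_add linear_diff linear_scale linear_neg linear_0)

lemma T2: "T u (w + w') v = T u w v + T u w' v" "T u (w - w') v = T u w v - T u w' v"
  "T u (c *\<^sub>R w) v = c * T u w v" "T u (- w) v = - T u w v"  "T u 0 v = 0"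
  by (simp_all add: s23[of u _ v] T3)

lemma T1: "T (w + w') u v = T w u v + T w' u v" "T (w - w') u v = T w u v - T w' u v"
  "T (c *\<^sub>R w) u v = c * T w u v" "T (- w) u v = - T w u v"  "T 0 u v = 0"
  by (simp_all add: s12[of _ u v] T2)

end

locale bounded_trilinear = semi_inner Q + symmetric_trilinear T
  for Q :: "'a::real_vector \<Rightarrow> 'a \<Rightarrow> real" and T :: "'a \<Rightarrow> 'a \<Rightarrow> 'a \<Rightarrow> real" +
  assumes diag: "\<bar>T u u u\<bar> \<le> N u ^ 3"
begin

text \<open>If the unit vector \<open>c e + s f\<close> has angle \<alpha>, then the left side
  without the absolute value is a convex combination of the diagonal values \<open>T w w w\<close>
  at the three unit vectors \<open>w\<close> of angles \<alpha>/3 + 2 pi j/3. Each of these is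
  bounded by 1 through \<open>diag\<close>. \<open>P\<close> is the cubic form
  \<open>T w w w\<close> in plane coordinates, and the triple-angle formulas link \<alpha> with
  \<alpha>/3.\<close>

lemma orthonormal_bound:
  assumes e: "Q e e = 1" and f: "Q f f = 1" and ef: "Q e f = 0" and cs: "c\<^sup>2 + s\<^sup>2 = 1"
  shows "\<bar>T e e (c *\<^sub>R e + s *\<^sub>R f)\<bar> \<le> 1"
proof -
  obtain \<alpha> where \<alpha>: "c = cos \<alpha>" "s = sin \<alpha>" using sincos_total_2pi[OF cs] by metis
  define C S where "C = cos (\<alpha> / 3)" and "S = sin (\<alpha> / 3)"
  have CS: "C\<^sup>2 + S\<^sup>2 = 1" by (simp add: C_def S_def)
  have "cos (\<alpha> / 3 + 2 * (\<alpha> / 3)) = C * (2 * C\<^sup>2 - 1) - S * (2 * S * C)"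
    unfolding cos_add cos_double_cos sin_double C_def S_def ..
  also have "\<dots> = 4 * C ^ 3 - 3 * C" using CS by algebra
  finally have c: "c = 4 * C ^ 3 - 3 * C" by (simp add: \<alpha>)
  have "sin (\<alpha> / 3 + 2 * (\<alpha> / 3)) = S * (1 - 2 * S\<^sup>2) + C * (2 * S * C)"
    unfolding sin_add cos_double_sin sin_double C_def S_def ..
  also have "\<dots> = 3 * S - 4 * S ^ 3" using CS by algebra
  finally have s: "s = 3 * S - 4 * S ^ 3" by (simp add: \<alpha>)
  define P where "P X Y = T e e e * X ^ 3 + 3 * T e e f * X\<^sup>2 * Y + 3 * T e f f * X * Y\<^sup>2 + T f f f * Y ^ 3" for X Y
  define W where "W X = (4 * X\<^sup>2 - 1)\<^sup>2 / 9" for X :: real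
  have P: "\<bar>P X Y\<bar> \<le> 1" if "X\<^sup>2 + Y\<^sup>2 = 1" for X Y
  proof -
    let ?w = "X *\<^sub>R e + Y *\<^sub>R f"
    have "Q ?w ?w = X\<^sup>2 + Y\<^sup>2"
      by (simp add: left right e f ef sym[of f e] power2_eq_square)
    then have "N ?w = 1" using that by (simp add: N_def)
    moreover have "T ?w ?w ?w = P X Y"
      unfolding P_def T1 T2 T3 using s12[of f e] s23[of e f e] s23[of f f e] s12[of f e f]
      by (simp add: power2_eq_square power3_eq_cube algebra_simps)
    ultimately show ?thesis using diag[of ?w] by simp
  qed
  define q where "q = sqrt 3"
  have q: "q\<^sup>2 = 3" by (simp add: q_def)
  note id = three_node_identity[OF CS q, folded P_def W_def]
  let ?C1 = "(- C - q * S) / 2" and ?S1 = "(q * C - S) / 2"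
  let ?C2 = "(- C + q * S) / 2" and ?S2 = "(- q * C - S) / 2"
  have W: "W X \<ge> 0" for X by (simp add: W_def)
  have "T e e (c *\<^sub>R e + s *\<^sub>R f) = W C * P C S + W ?C1 * P ?C1 ?S1 + W ?C2 * P ?C2 ?S2"
    using id(1)[of "T e e e" "T e e f" "T e f f" "T f f f", folded P_def]
    by (simp add: T3 c s mult.commute)
  also have "\<bar>\<dots>\<bar> \<le> \<bar>W C * P C S\<bar> + \<bar>W ?C1 * P ?C1 ?S1\<bar> + \<bar>W ?C2 * P ?C2 ?S2\<bar>" by linarith
  also have "\<dots> \<le> W C * 1 + W ?C1 * 1 + W ?C2 * 1"
    unfolding abs_mult using P[OF CS] P[OF id(3)] P[OF id(4)] W
    by (intro add_mono mult_mono) auto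
  also have "\<dots> = 1" using id(2) by simp
  finally show ?thesis .
qed

text \<open>After normalization everything happens in the plane of \<open>u\<close> and
  \<open>v\<close>; Gram-Schmidt supplies the orthonormal pair, unless the two vectors are parallel,
  when the diagonal bound suffices.\<close>

lemma posdef_bound2:
  assumes pos: "\<And>u. u \<noteq> 0 \<Longrightarrow> 0 < Q u u"
  shows "\<bar>T u u v\<bar> \<le> (N u)\<^sup>2 * N v"
proof (cases "u = 0 \<or> v = 0")
  case True
  then show ?thesis by (auto simp: T1 T3)
next
  case False
  then have Nu: "N u > 0" and Nv: "N v > 0" using pos by (auto simp: N_def)
  define e where "e = (1 / N u) *\<^sub>R u"
  define v' where "v' = (1 / N v) *\<^sub>R v"
  have e: "Q e e = 1" using Nu normalized by (simp add: e_def)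
  have v': "Q v' v' = 1" using Nv normalized by (simp add: v'_def)
  define c where "c = Q e v'"
  define w where "w = v' - c *\<^sub>R e"
  have ew: "Q e w = 0" by (simp add: w_def right c_def e)
  have ww: "Q w w = 1 - c\<^sup>2" by (simp add: w_def left right e v' sym[of v' e] flip: c_def) (simp add: power2_eq_square)
  have "\<bar>T e e v'\<bar> \<le> 1"
  proof (cases "w = 0")
    case True
    have "c\<^sup>2 = 1" using ww True by (simp add: left)
    then have "\<bar>c\<bar> = 1" by (auto simp: power2_eq_1_iff)
    moreover have "v' = c *\<^sub>R e" using True by (simp add: w_def)
    moreover have "\<bar>T e e e\<bar> \<le> 1" using diag[of e] e by (simp add: N_def)
    ultimately show ?thesis by (simp add: T3 abs_mult)
  next
    case False
    define s where "s = N w"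
    have s: "s > 0" using pos[OF False] by (simp add: s_def N_def)
    have "Q ((1 / s) *\<^sub>R w) ((1 / s) *\<^sub>R w) = 1"
      using s normalized by (simp add: s_def)
    moreover have "Q e ((1 / s) *\<^sub>R w) = 0" by (simp add: right ew)
    moreover have "c\<^sup>2 + s\<^sup>2 = 1" using ww by (simp add: s_def N_sq)
    ultimately have "\<bar>T e e (c *\<^sub>R e + s *\<^sub>R ((1 / s) *\<^sub>R w))\<bar> \<le> 1"
      using orthonormal_bound[OF e] by blast
    then show ?thesis using s by (simp add: w_def)
  qed
  moreover have "T u u v = (N u)\<^sup>2 * N v * T e e v'"
    using Nu Nv by (simp add: e_def v'_def T1 T2 T3 power2_eq_square)
  ultimately show ?thesis
    using Nu Nv mult_left_mono[of "\<bar>T e e v'\<bar>" 1 "(N u)\<^sup>2 * N v"] by (simp add: abs_mult)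
qed

text \<open>Polarization in the last two arguments loses nothing for unit vectors, because the
  parallelogram identity makes the two squared norms add up to exactly 4.\<close>

lemma posdef_bound3:
  assumes pos: "\<And>u. u \<noteq> 0 \<Longrightarrow> 0 < Q u u"
  shows "\<bar>T u v w\<bar> \<le> N u * N v * N w"
proof (cases "v = 0 \<or> w = 0")
  case True
  then show ?thesis by (auto simp: T2 T3)
next
  case False
  then have Nv: "N v > 0" and Nw: "N w > 0" using pos by (auto simp: N_def)
  have b: "\<bar>T u z z\<bar> \<le> N u * Q z z" for z
    using posdef_bound2[OF pos, of z u] s23[of z z u] s12[of u z z] by (simp add: N_sq mult.commute)
  let ?v = "(1 / N v) *\<^sub>R v" and ?w = "(1 / N w) *\<^sub>R w"
  have vw: "Q ?v ?v = 1" "Q ?w ?w = 1"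
    using Nv Nw normalized by blast+
  have "4 * T u ?v ?w = T u (?v + ?w) (?v + ?w) - T u (?v - ?w) (?v - ?w)"
    unfolding T2(1,2) T3(1,2) using s23[of u ?w ?v] by simp
  moreover have "Q (?v + ?w) (?v + ?w) + Q (?v - ?w) (?v - ?w) = 4"
    unfolding left(1,2) right(1,2) using vw by linarith
  then have "N u * Q (?v + ?w) (?v + ?w) + N u * Q (?v - ?w) (?v - ?w) = 4 * N u"
    by (metis distrib_left mult.commute)
  ultimately have "\<bar>T u ?v ?w\<bar> \<le> N u"
    using b[of "?v + ?w"] b[of "?v - ?w"] by linarith
  moreover have "T u v w = N v * N w * T u ?v ?w" using Nv Nw by (simp add: T2 T3)
  ultimately show ?thesis
    using Nv Nw mult_left_mono[of "\<bar>T u ?v ?w\<bar>" "N u" "N v * N w"] by (simp add: abs_mult mult_ac)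
qed

end

text \<open>The semidefinite case follows from the definite one applied to \<open>Q + \<epsilon> (\<bullet>)\<close>.\<close>

lemma bounded_trilinear_bound:
  fixes Q :: "'a::real_inner \<Rightarrow> 'a \<Rightarrow> real"
  assumes "bounded_trilinear Q T"
  shows "\<bar>T u v w\<bar> \<le> sqrt (Q u u) * sqrt (Q v v) * sqrt (Q w w)"
proof -
  interpret bounded_trilinear Q T by fact
  define Q' where "Q' e u v = Q u v + e * (u \<bullet> v)" for e :: real and u v :: 'a
  have bound: "\<bar>T u v w\<bar> \<le> sqrt (Q' e u u) * sqrt (Q' e v v) * sqrt (Q' e w w)" if e: "e > 0" for e
  proof -
    have pos: "0 < Q' e u u" if "u \<noteq> 0" for u
      using e nonneg[of u] that by (simp add: Q'_def add_nonneg_pos)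
    interpret E: semi_inner "Q' e"
    proof (rule semi_inner.intro)
      fix u v :: 'a
      show "linear (Q' e u)"
        by (rule linearI) (simp_all add: Q'_def right inner_add_right algebra_simps)
      show "Q' e u v = Q' e v u" by (simp add: Q'_def sym[of u v] inner_commute)
      show "0 \<le> Q' e u u" using e nonneg[of u] by (simp add: Q'_def)
    qed
    interpret E: bounded_trilinear "Q' e" T
    proof
      fix u :: 'a
      have "N u \<le> E.N u" using e by (simp add: N_def E.N_def Q'_def)
      then show "\<bar>T u u u\<bar> \<le> E.N u ^ 3"
        using diag[of u] power_mono[OF _ N_nonneg, of u "E.N u" 3] by linarith
    qed
    show ?thesis using E.posdef_bound3[OF pos] by (simp add: E.N_def)
  qed
  have "((\<lambda>e. sqrt (Q' e u u) * sqrt (Q' e v v) * sqrt (Q' e w w)) \<longlongrightarrow>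
    sqrt (Q' 0 u u) * sqrt (Q' 0 v v) * sqrt (Q' 0 w w)) (at_right 0)"
    unfolding Q'_def by (intro tendsto_intros)
  then have "\<bar>T u v w\<bar> \<le> sqrt (Q' 0 u u) * sqrt (Q' 0 v v) * sqrt (Q' 0 w w)"
    by (rule tendsto_lowerbound) (use bound in \<open>auto simp: eventually_at_right_less intro: eventually_mono[OF eventually_at_right_less]\<close>)
  then show ?thesis by (simp add: Q'_def)
qed

section \<open>Self-concordant functions\<close>

text \<open>The description operator in \<open>grad\<close> is justified by the Riesz representation
  of the derivative: \<open>adjoint F 1\<close> is the representing vector, and inner products
  determine it uniquely.\<close>

lemma has_derivative_grad:
  assumes "f differentiable (at x)"
  shows "(f has_derivative (\<lambda>h. grad f x \<bullet> h)) (at x)"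
proof -
  obtain F where F: "(f has_derivative F) (at x)" using assms by (auto simp: differentiable_def)
  interpret bounded_linear F using F has_derivative_bounded_linear by blast
  have adj: "F h = h \<bullet> adjoint F 1" for h
    using adjoint_works[OF linear_axioms, of h 1] by simp
  then have "F = (\<lambda>h. h \<bullet> adjoint F 1)" by blast
  then have g: "GDERIV f x :> adjoint F 1" using F unfolding gderiv_def by simp
  have uniq: "g = g'" if "GDERIV f x :> g" "GDERIV f x :> g'" for g g'
  proof -
    have "(\<lambda>h. h \<bullet> g) = (\<lambda>h. h \<bullet> g')"
      using that has_derivative_unique unfolding gderiv_def by blast
    then have "h \<bullet> g = h \<bullet> g'" for h by (rule fun_cong)
    from this[of "g - g'"] have "(g - g') \<bullet> (g - g') = 0" by (simp add: inner_diff_right)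
    then show ?thesis by simp
  qed
  have "GDERIV f x :> grad f x"
    unfolding grad_def using theI[of "\<lambda>g. GDERIV f x :> g", OF g uniq[OF _ g]] .
  then show ?thesis by (simp add: gderiv_def inner_commute)
qed

lemma has_derivative_hess:
  assumes "grad f differentiable (at x)"
  shows "(grad f has_derivative (\<lambda>h. hess f x *v h)) (at x)"
proof -
  have "(grad f has_derivative frechet_derivative (grad f) (at x)) (at x)"
    using assms frechet_derivative_works by blast
  moreover from has_derivative_linear[OF this]
  have "frechet_derivative (grad f) (at x) = (\<lambda>h. hess f x *v h)"
    unfolding hess_def by (rule matrix_vector_mul(2)[symmetric])
  ultimately show ?thesis by (rule has_derivative_eq_rhs)
qed

lemma line_has_derivative: "((\<lambda>\<tau>. p + \<tau> *\<^sub>R v) has_derivative (\<lambda>h. h *\<^sub>R v)) (at \<tau>)"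
  by (auto intro!: derivative_eq_intros)

locale self_concordant =
  fixes f :: "real ^ 'n \<Rightarrow> real" and a :: real and D :: "(real ^ 'n) set"
  assumes a: "0 < a" and open_D: "open D" and convex_D: "convex D" and sc: "self_concordant_on a D f"
begin

abbreviation B :: "real ^ 'n \<Rightarrow> real ^ 'n \<Rightarrow> real ^ 'n \<Rightarrow> real" where
  "B \<equiv> local_inner a f"

text \<open>The gradient in the scaling of \<open>B\<close>, so that its derivative along a line is
  \<open>B\<close> itself. Residuals will be bounds \<open>\<bar>G x w\<bar> \<le> c * N w\<close>
  for all \<open>w\<close>, that is, dual norms; this avoids estimating inverse matrices.\<close>

definition G :: "real ^ 'n \<Rightarrow> real ^ 'n \<Rightarrow> real" where
  "G x w = inverse a * (grad f x \<bullet> w)"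

text \<open>The factor \<open>1 / (2 * a)\<close> turns the self-concordance inequality into a
  diagonal bound with constant 1; the price is the factor 2 in the derivative of
  \<open>B\<close>.\<close>

definition T :: "real ^ 'n \<Rightarrow> real ^ 'n \<Rightarrow> real ^ 'n \<Rightarrow> real ^ 'n \<Rightarrow> real" where
  "T x u v w = inverse (2 * a) * ((third_deriv f x u *v v) \<bullet> w)"

lemma
  assumes "x \<in> D"
  shows f_deriv: "(f has_derivative (\<lambda>h. grad f x \<bullet> h)) (at x)"
    and grad_deriv: "(grad f has_derivative (\<lambda>h. hess f x *v h)) (at x)"
    and hess_deriv: "(hess f has_derivative third_deriv f x) (at x)"
proof -
  have d: "f differentiable (at x)" "grad f differentiable (at x)" "hess f differentiable (at x)"
    using sc assms by (auto simp: self_concordant_on_def C3_on_def)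
  from d(1) show "(f has_derivative (\<lambda>h. grad f x \<bullet> h)) (at x)" by (rule has_derivative_grad)
  from d(2) show "(grad f has_derivative (\<lambda>h. hess f x *v h)) (at x)" by (rule has_derivative_hess)
  from d(3) show "(hess f has_derivative third_deriv f x) (at x)"
    unfolding third_deriv_def by (simp only: frechet_derivative_works)
qed

lemma hess_sym: "x \<in> D \<Longrightarrow> (hess f x *v u) \<bullet> v = (hess f x *v v) \<bullet> u"
  using second_derivative_symmetric[OF open_D _ f_deriv grad_deriv] by blast

lemma hess_deriv_inner:
  assumes "x \<in> D"
  shows "((\<lambda>x. (hess f x *v u) \<bullet> w) has_derivative (\<lambda>h. (third_deriv f x h *v u) \<bullet> w)) (at x)"
proof -
  have "linear (\<lambda>A :: real ^ 'n ^ 'n. (A *v u) \<bullet> w)"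
    by (rule linearI) (simp_all add: matrix_vector_mult_add_rdistrib inner_add_left scaleR_matrix_vector_assoc[symmetric])
  then have "bounded_linear (\<lambda>A :: real ^ 'n ^ 'n. (A *v u) \<bullet> w)"
    by (simp only: linear_conv_bounded_linear)
  from bounded_linear.has_derivative[OF this hess_deriv[OF assms]] show ?thesis .
qed

text \<open>The symmetry of the Hessian holds on the whole open set \<open>D\<close>, so it may be
  differentiated.\<close>

lemma third_sym23:
  assumes "x \<in> D"
  shows "(third_deriv f x u *v v) \<bullet> w = (third_deriv f x u *v w) \<bullet> v"
proof -
  have "((\<lambda>x. (hess f x *v w) \<bullet> v) has_derivative (\<lambda>h. (third_deriv f x h *v v) \<bullet> w)) (at x)"
    using hess_deriv_inner[OF assms, of v w] hess_sym
    by (rule has_derivative_transform_within_open[OF _ open_D assms])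
  then show ?thesis
    using has_derivative_unique[OF _ hess_deriv_inner[OF assms, of w v]] by meson
qed

text \<open>The symmetry of second derivatives is applied to the scalar function
  \<open>grad f y \<bullet> w\<close>, whose gradient at \<open>y\<close> is
  \<open>hess f y *v w\<close>.\<close>

lemma third_sym12:
  assumes "x \<in> D"
  shows "(third_deriv f x u *v v) \<bullet> w = (third_deriv f x v *v u) \<bullet> w"
proof -
  have 1: "((\<lambda>y. grad f y \<bullet> w) has_derivative (\<lambda>h. (hess f y *v w) \<bullet> h)) (at y)" if "y \<in> D" for y
    using has_derivative_inner_left[OF grad_deriv[OF that], of w] hess_sym[OF that, of _ w] by simp
  have "linear (\<lambda>A :: real ^ 'n ^ 'n. A *v w)"
    by (rule linearI) (simp_all add: matrix_vector_mult_add_rdistrib scaleR_matrix_vector_assoc[symmetric])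
  then have "bounded_linear (\<lambda>A :: real ^ 'n ^ 'n. A *v w)"
    by (simp only: linear_conv_bounded_linear)
  from bounded_linear.has_derivative[OF this hess_deriv[OF assms]]
  have 2: "((\<lambda>y. hess f y *v w) has_derivative (\<lambda>h. third_deriv f x h *v w)) (at x)" .
  have "(third_deriv f x u *v w) \<bullet> v = (third_deriv f x v *v w) \<bullet> u"
    using second_derivative_symmetric[OF open_D assms 1 2] .
  then show ?thesis using third_sym23[OF assms] by metis
qed

section \<open>Convexity and derivatives along segments\<close>

lemma gradient_inequality:
  assumes x: "x \<in> D" and y: "y \<in> D"
  shows "grad f x \<bullet> (y - x) \<le> f y - f x"
proof (rule ccontr)
  assume neg: "\<not> ?thesis"
  \<comment> \<open>\<open>f\<close> along the segment minus the slope of its chord. Convexity puts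
    \<open>\<psi> h\<close> below \<open>\<psi> 0\<close>, while failure of the inequality would
    give \<open>\<psi>\<close> a positive slope at 0.\<close>
  define \<psi> where "\<psi> t = f (x + t *\<^sub>R (y - x)) - t * (f y - f x)" for t
  have "((\<lambda>t. f (x + t *\<^sub>R (y - x))) has_derivative (\<lambda>h. grad f x \<bullet> (h *\<^sub>R (y - x)))) (at 0)"
    by (rule has_derivative_compose[OF line_has_derivative]) (simp add: f_deriv[OF x])
  then have "((\<lambda>t. f (x + t *\<^sub>R (y - x))) has_real_derivative grad f x \<bullet> (y - x)) (at 0)"
    unfolding has_field_derivative_def by (rule has_derivative_eq_rhs) (simp add: fun_eq_iff mult.commute)
  then have "(\<psi> has_real_derivative grad f x \<bullet> (y - x) - (f y - f x)) (at 0)"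
    unfolding \<psi>_def by (auto intro!: derivative_eq_intros)
  then obtain d where d: "d > 0" "\<And>h. 0 < h \<Longrightarrow> h < d \<Longrightarrow> \<psi> 0 < \<psi> (0 + h)"
    using DERIV_pos_inc_right neg by (metis diff_gt_0_iff_gt not_le)
  define h where "h = min (d / 2) (1 / 2)"
  have h: "0 < h" "h < d" "h < 1" using d by (auto simp: h_def)
  have "x \<noteq> y" using neg by auto
  then have "f ((1 - h) *\<^sub>R x + h *\<^sub>R y) < (1 - h) * f x + h * f y"
    using sc x y h unfolding self_concordant_on_def strictly_convex_on_def by blast
  moreover have "(1 - h) *\<^sub>R x + h *\<^sub>R y = x + h *\<^sub>R (y - x)" by (simp add: algebra_simps)
  ultimately have "\<psi> h < \<psi> 0" by (simp add: \<psi>_def algebra_simps)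
  then show False using d(2)[of h] h by simp
qed

lemma segment_in_D:
  assumes "p \<in> D" "p + v \<in> D" "0 \<le> \<tau>" "\<tau> \<le> 1"
  shows "p + \<tau> *\<^sub>R v \<in> D"
proof -
  have "(1 - \<tau>) *\<^sub>R p + \<tau> *\<^sub>R (p + v) \<in> D"
    using assms by (intro convexD_alt[OF convex_D]) auto
  then show ?thesis by (simp add: algebra_simps)
qed

lemma G_line_deriv:
  assumes "p + \<tau> *\<^sub>R v \<in> D"
  shows "((\<lambda>\<tau>. G (p + \<tau> *\<^sub>R v) w) has_real_derivative B (p + \<tau> *\<^sub>R v) v w) (at \<tau>)"
proof -
  have "((\<lambda>\<tau>. grad f (p + \<tau> *\<^sub>R v) \<bullet> w) has_derivative (\<lambda>h. (hess f (p + \<tau> *\<^sub>R v) *v (h *\<^sub>R v)) \<bullet> w)) (at \<tau>)"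
    by (rule has_derivative_inner_left has_derivative_compose[OF line_has_derivative grad_deriv[OF assms]])+
  then have "((\<lambda>\<tau>. grad f (p + \<tau> *\<^sub>R v) \<bullet> w) has_real_derivative (hess f (p + \<tau> *\<^sub>R v) *v v) \<bullet> w) (at \<tau>)"
    unfolding has_field_derivative_def
    by (rule has_derivative_eq_rhs) (simp add: fun_eq_iff matrix_vector_mult_scaleR)
  then show ?thesis
    unfolding G_def local_inner_def by (rule DERIV_cmult)
qed

lemma B_line_deriv:
  assumes "p + \<tau> *\<^sub>R v \<in> D"
  shows "((\<lambda>\<tau>. B (p + \<tau> *\<^sub>R v) u w) has_real_derivative 2 * T (p + \<tau> *\<^sub>R v) v u w) (at \<tau>)"
proof -
  have lin: "linear (third_deriv f (p + \<tau> *\<^sub>R v))" using hess_deriv[OF assms] has_derivative_linear by blast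
  have "((\<lambda>\<tau>. (hess f (p + \<tau> *\<^sub>R v) *v u) \<bullet> w) has_derivative (\<lambda>h. (third_deriv f (p + \<tau> *\<^sub>R v) (h *\<^sub>R v) *v u) \<bullet> w)) (at \<tau>)"
    by (rule has_derivative_compose[OF line_has_derivative hess_deriv_inner[OF assms]])
  then have "((\<lambda>\<tau>. (hess f (p + \<tau> *\<^sub>R v) *v u) \<bullet> w) has_real_derivative (third_deriv f (p + \<tau> *\<^sub>R v) v *v u) \<bullet> w) (at \<tau>)"
    unfolding has_field_derivative_def
    by (rule has_derivative_eq_rhs) (simp add: fun_eq_iff linear_scale[OF lin] scaleR_matrix_vector_assoc[symmetric])
  then have "((\<lambda>\<tau>. B (p + \<tau> *\<^sub>R v) u w) has_real_derivative inverse a * ((third_deriv f (p + \<tau> *\<^sub>R v) v *v u) \<bullet> w)) (at \<tau>)"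
    unfolding local_inner_def by (rule DERIV_cmult)
  then show ?thesis using a by (simp add: T_def field_simps)
qed

text \<open>Adding the gradient inequality in both directions shows that the gradient is monotone
  along lines; a negative second derivative would make it decrease.\<close>

lemma B_nonneg:
  assumes x: "x \<in> D"
  shows "0 \<le> B x u u"
proof (rule ccontr)
  assume neg: "\<not> ?thesis"
  have "((\<lambda>\<tau>. G (x + \<tau> *\<^sub>R u) u) has_real_derivative B x u u) (at 0)"
    using G_line_deriv[of x 0 u u] x by simp
  then obtain d where d: "d > 0" "\<And>h. 0 < h \<Longrightarrow> h < d \<Longrightarrow> G (x + (0 + h) *\<^sub>R u) u < G (x + 0 *\<^sub>R u) u"
    using DERIV_neg_dec_right neg by (metis not_le)
  have "\<forall>\<^sub>F h in at_right 0. x + h *\<^sub>R u \<in> D"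
  proof -
    have "((\<lambda>h. x + h *\<^sub>R u) \<longlongrightarrow> x + 0 *\<^sub>R u) (at_right 0)" by (intro tendsto_intros)
    then show ?thesis using topological_tendstoD[OF _ open_D] x by simp
  qed
  moreover have "\<forall>\<^sub>F h in at_right 0. 0 < h \<and> h < d"
    using d(1) by (auto simp: eventually_at_right_field)
  ultimately have "\<forall>\<^sub>F h in at_right 0. x + h *\<^sub>R u \<in> D \<and> 0 < h \<and> h < d"
    by eventually_elim auto
  then obtain h :: real where h: "x + h *\<^sub>R u \<in> D" "0 < h" "h < d"
    using eventually_happens'[OF trivial_limit_at_right_real] by blast
  have "grad f x \<bullet> (h *\<^sub>R u) \<le> f (x + h *\<^sub>R u) - f x"
    using gradient_inequality[OF x h(1)] by simp
  moreover have "grad f (x + h *\<^sub>R u) \<bullet> (- (h *\<^sub>R u)) \<le> f x - f (x + h *\<^sub>R u)"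
    using gradient_inequality[OF h(1) x] by simp
  ultimately have "h * (grad f x \<bullet> u) \<le> h * (grad f (x + h *\<^sub>R u) \<bullet> u)" by simp
  then have "grad f x \<bullet> u \<le> grad f (x + h *\<^sub>R u) \<bullet> u" using h by simp
  then have "G x u \<le> G (x + h *\<^sub>R u) u" using a by (simp add: G_def)
  then show False using d(2)[OF h(2,3)] by simp
qed

lemma semi_inner_B:
  assumes "x \<in> D"
  shows "semi_inner (B x)"
proof (rule semi_inner.intro)
  fix u v
  show "linear (B x u)"
    by (rule linearI) (simp_all add: local_inner_def inner_add_right distrib_left)
  show "B x u v = B x v u" unfolding local_inner_def using hess_sym[OF assms] by metis
  show "0 \<le> B x u u" using B_nonneg[OF assms] .
qed

lemma N_local_norm: "x \<in> D \<Longrightarrow> semi_inner.N (B x) = local_norm a f x"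
  by (auto simp: fun_eq_iff local_norm_def semi_inner.N_def[OF semi_inner_B])

section \<open>Bounds for the third derivative\<close>

lemma T_diag:
  assumes x: "x \<in> D"
  shows "\<bar>T x u u u\<bar> \<le> local_norm a f x u ^ 3"
proof -
  define h where "h = (hess f x *v u) \<bullet> u"
  have h: "h \<ge> 0" using B_nonneg[OF x, of u] a by (simp add: local_inner_def h_def zero_le_mult_iff)
  have "\<bar>T x u u u\<bar> = inverse (2 * a) * \<bar>(third_deriv f x u *v u) \<bullet> u\<bar>"
    using a by (simp add: T_def abs_mult)
  also have "\<dots> \<le> inverse (2 * a) * (2 * a powr (- 1 / 2) * h powr (3 / 2))"
    using sc x a unfolding self_concordant_on_def h_def by (intro mult_left_mono) auto
  also have "\<dots> = inverse a * a powr (- 1 / 2) * h powr (3 / 2)" using a by simp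
  also have "h powr (3 / 2) = sqrt h ^ 3"
    using h by (cases "h = 0") (simp_all add: powr_half_sqrt[symmetric] powr_powr powr_realpow[symmetric])
  also have "a powr (- 1 / 2) = inverse (sqrt a)"
    using a by (simp add: powr_minus powr_half_sqrt[symmetric] minus_divide_left[symmetric] del: minus_divide_left)
  also have "inverse a * inverse (sqrt a) = inverse (sqrt a) ^ 3"
    using a by (simp add: power3_eq_cube field_simps)
  finally show ?thesis
    by (simp add: local_norm_def local_inner_def h_def real_sqrt_mult real_sqrt_inverse power_mult_distrib)
qed

lemma T_bound:
  assumes x: "x \<in> D"
  shows "\<bar>T x u v w\<bar> \<le> local_norm a f x u * local_norm a f x v * local_norm a f x w"
proof -
  interpret semi_inner "B x" by (rule semi_inner_B[OF x])
  have "symmetric_trilinear (T x)"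
  proof (rule symmetric_trilinear.intro)
    fix u v w
    show "linear (T x u v)"
      by (rule linearI) (simp_all add: T_def inner_add_right distrib_left)
    show "T x u v w = T x v u w" unfolding T_def using third_sym12[OF x] by metis
    show "T x u v w = T x u w v" unfolding T_def using third_sym23[OF x] by metis
  qed
  then have "bounded_trilinear (B x) (T x)"
    using T_diag[OF x] semi_inner_axioms
    by (simp add: bounded_trilinear_def bounded_trilinear_axioms_def N_local_norm[OF x])
  then show ?thesis using bounded_trilinear_bound unfolding local_norm_def by blast
qed

end

section \<open>Comparison of Hessians along a segment\<close>

context self_concordant
begin

text \<open>The length p of \<open>v\<close> in the local norm at
  \<open>x + \<tau> *\<^sub>R v\<close> satisfies |p'| <= p^2, hence 1/p + \<tau> is nondecreasing.
  Since p may vanish, its square is first increased by \<open>e\<close>, and \<open>e\<close> then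
  tends to 0; the product form of the claim survives this limit.\<close>

lemma line_norm_bound:
  assumes D: "x \<in> D" "x + v \<in> D" and \<tau>: "0 \<le> \<tau>" "\<tau> \<le> 1"
  shows "local_norm a f (x + \<tau> *\<^sub>R v) v * (1 - \<tau> * local_norm a f x v) \<le> local_norm a f x v"
proof -
  define w where "w \<sigma> = B (x + \<sigma> *\<^sub>R v) v v" for \<sigma>
  have w0: "w \<sigma> \<ge> 0" if "0 \<le> \<sigma>" "\<sigma> \<le> 1" for \<sigma>
    using B_nonneg segment_in_D[OF D that] by (simp add: w_def)
  have ineq: "sqrt (w \<tau> + e) * (1 - \<tau> * sqrt (w 0 + e)) \<le> sqrt (w 0 + e)" if e: "e > 0" for e
  proof -
    have pos: "w \<sigma> + e > 0" if "0 \<le> \<sigma>" "\<sigma> \<le> 1" for \<sigma> using w0[OF that] e by simp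
    have "inverse (sqrt (w 0 + e)) + 0 \<le> inverse (sqrt (w \<tau> + e)) + \<tau>"
    proof (rule DERIV_nonneg_imp_nondecreasing[OF \<tau>(1), of "\<lambda>\<sigma>. inverse (sqrt (w \<sigma> + e)) + \<sigma>"])
      fix \<sigma> assume "0 \<le> \<sigma>" "\<sigma> \<le> \<tau>"
      then have \<sigma>: "0 \<le> \<sigma>" "\<sigma> \<le> 1" using \<tau> by auto
      let ?t = "T (x + \<sigma> *\<^sub>R v) v v v" and ?S = "sqrt (w \<sigma> + e)"
      note mem = segment_in_D[OF D \<sigma>]
      have S: "?S > 0" using pos[OF \<sigma>] by simp
      have SS: "inverse ?S * inverse ?S = inverse (w \<sigma> + e)"
        using pos[OF \<sigma>] by (simp flip: inverse_mult_distrib)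
      have "(w has_real_derivative 2 * ?t) (at \<sigma>)"
        unfolding w_def by (rule B_line_deriv[OF mem])
      then have "((\<lambda>\<sigma>. inverse (sqrt (w \<sigma> + e)) + \<sigma>) has_real_derivative - (2 * ?t * (inverse ?S / 2) * inverse (?S\<^sup>2)) + 1) (at \<sigma>)"
        using pos[OF \<sigma>] SS by (auto intro!: derivative_eq_intros simp: power2_eq_square)
      moreover have "\<bar>?t\<bar> \<le> ?S ^ 3"
      proof -
        have "local_norm a f (x + \<sigma> *\<^sub>R v) v = sqrt (w \<sigma>)" by (simp add: local_norm_def w_def)
        then have "\<bar>?t\<bar> \<le> sqrt (w \<sigma>) ^ 3" using T_diag[OF mem, of v] by simp
        also have "\<dots> \<le> ?S ^ 3" using w0[OF \<sigma>] e by (intro power_mono) auto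
        finally show ?thesis .
      qed
      then have "2 * ?t * (inverse ?S / 2) * inverse (?S\<^sup>2) \<le> 1"
        using S by (simp add: power2_eq_square power3_eq_cube field_simps del: real_sqrt_mult_self)
      ultimately show "\<exists>y. ((\<lambda>\<sigma>. inverse (sqrt (w \<sigma> + e)) + \<sigma>) has_real_derivative y) (at \<sigma>) \<and> 0 \<le> y"
        by (intro exI[of _ "- (2 * ?t * (inverse ?S / 2) * inverse (?S\<^sup>2)) + 1"]) auto
    qed
    then show ?thesis using pos[of 0] pos[OF \<tau>] by (simp add: field_simps)
  qed
  have "((\<lambda>e. sqrt (w \<tau> + e) * (1 - \<tau> * sqrt (w 0 + e))) \<longlongrightarrow> sqrt (w \<tau> + 0) * (1 - \<tau> * sqrt (w 0 + 0))) (at_right 0)"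
    "((\<lambda>e. sqrt (w 0 + e)) \<longlongrightarrow> sqrt (w 0 + 0)) (at_right 0)"
    by (intro tendsto_intros)+
  then have "sqrt (w \<tau> + 0) * (1 - \<tau> * sqrt (w 0 + 0)) \<le> sqrt (w 0 + 0)"
    by (intro tendsto_le[OF trivial_limit_at_right_real]) (auto intro: eventually_mono[OF eventually_at_right_less] ineq)
  then show ?thesis by (simp add: w_def local_norm_def)
qed

text \<open>The trilinear bound and \<open>line_norm_bound\<close> give a differential inequality
  for \<open>q\<close>: its logarithmic derivative is at most
  \<open>2 * \<rho> / (1 - \<tau> * \<rho>)\<close> in size. Multiplying or dividing
  \<open>q\<close> by \<open>(1 - \<tau> * \<rho>)^2\<close> therefore makes it monotone, without
  any division by \<open>q\<close>.\<close>

lemma hess_comparison: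
  assumes D: "x \<in> D" "x + v \<in> D" and \<rho>: "local_norm a f x v < 1"
  shows "(1 - local_norm a f x v)\<^sup>2 * B x u u \<le> B (x + v) u u"
    and "(1 - local_norm a f x v)\<^sup>2 * B (x + v) u u \<le> B x u u"
proof -
  define \<rho> where "\<rho> = local_norm a f x v"
  have \<rho>0: "\<rho> \<ge> 0" using B_nonneg[OF D(1)] by (simp add: \<rho>_def local_norm_def)
  have pos: "1 - \<tau> * \<rho> > 0" if "0 \<le> \<tau>" "\<tau> \<le> 1" for \<tau>
    using that \<rho> \<rho>0 mult_right_mono[of \<tau> 1 \<rho>] by (simp add: \<rho>_def)
  define q where "q \<tau> = B (x + \<tau> *\<^sub>R v) u u" for \<tau>
  define t where "t \<tau> = T (x + \<tau> *\<^sub>R v) v u u" for \<tau>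
  have q': "(q has_real_derivative 2 * t \<tau>) (at \<tau>)" if "0 \<le> \<tau>" "\<tau> \<le> 1" for \<tau>
    unfolding q_def t_def using B_line_deriv[OF segment_in_D[OF D that]] .
  have t: "(1 - \<tau> * \<rho>) * \<bar>t \<tau>\<bar> \<le> \<rho> * q \<tau>" if "0 \<le> \<tau>" "\<tau> \<le> 1" for \<tau>
  proof -
    note mem = segment_in_D[OF D that]
    have n: "local_norm a f (x + \<tau> *\<^sub>R v) u * local_norm a f (x + \<tau> *\<^sub>R v) u = q \<tau>" "0 \<le> q \<tau>"
      using B_nonneg[OF mem, of u] by (simp_all add: local_norm_def q_def)
    have "\<bar>t \<tau>\<bar> \<le> local_norm a f (x + \<tau> *\<^sub>R v) v * q \<tau>"
      using T_bound[OF mem, of v u u] n by (simp add: t_def mult.assoc)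
    then have "(1 - \<tau> * \<rho>) * \<bar>t \<tau>\<bar> \<le> (1 - \<tau> * \<rho>) * (local_norm a f (x + \<tau> *\<^sub>R v) v * q \<tau>)"
      using pos[OF that] by (intro mult_left_mono) auto
    also have "\<dots> = (local_norm a f (x + \<tau> *\<^sub>R v) v * (1 - \<tau> * \<rho>)) * q \<tau>" by simp
    also have "\<dots> \<le> \<rho> * q \<tau>"
      using line_norm_bound[OF D that] n by (intro mult_right_mono) (auto simp: \<rho>_def)
    finally show ?thesis .
  qed
  have "(1 - 0 * \<rho>)\<^sup>2 * q 0 \<ge> (1 - 1 * \<rho>)\<^sup>2 * q 1"
  proof (rule DERIV_nonpos_imp_nonincreasing[of 0 1 "\<lambda>\<tau>. (1 - \<tau> * \<rho>)\<^sup>2 * q \<tau>"])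
    fix \<tau> :: real assume \<tau>: "0 \<le> \<tau>" "\<tau> \<le> 1"
    have "((\<lambda>\<tau>. (1 - \<tau> * \<rho>)\<^sup>2 * q \<tau>) has_real_derivative
      2 * (1 - \<tau> * \<rho>) * ((1 - \<tau> * \<rho>) * t \<tau> - \<rho> * q \<tau>)) (at \<tau>)"
      using q'[OF \<tau>] by (auto intro!: derivative_eq_intros simp: algebra_simps power2_eq_square)
    moreover have "(1 - \<tau> * \<rho>) * t \<tau> \<le> (1 - \<tau> * \<rho>) * \<bar>t \<tau>\<bar>" using pos[OF \<tau>] by (intro mult_left_mono) auto
    then have "(1 - \<tau> * \<rho>) * t \<tau> - \<rho> * q \<tau> \<le> 0" using t[OF \<tau>] by linarith
    then have "2 * (1 - \<tau> * \<rho>) * ((1 - \<tau> * \<rho>) * t \<tau> - \<rho> * q \<tau>) \<le> 0"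
      using pos[OF \<tau>] by (intro mult_nonneg_nonpos) simp_all
    ultimately show "\<exists>y. ((\<lambda>\<tau>. (1 - \<tau> * \<rho>)\<^sup>2 * q \<tau>) has_real_derivative y) (at \<tau>) \<and> y \<le> 0" by blast
  qed simp
  then show "(1 - local_norm a f x v)\<^sup>2 * B (x + v) u u \<le> B x u u"
    by (simp add: q_def \<rho>_def)
  have "q 0 / (1 - 0 * \<rho>)\<^sup>2 \<le> q 1 / (1 - 1 * \<rho>)\<^sup>2"
  proof (rule DERIV_nonneg_imp_nondecreasing[of 0 1 "\<lambda>\<tau>. q \<tau> / (1 - \<tau> * \<rho>)\<^sup>2"])
    fix \<tau> :: real assume \<tau>: "0 \<le> \<tau>" "\<tau> \<le> 1"
    let ?s = "1 - \<tau> * \<rho>"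
    have der: "((\<lambda>\<tau>. q \<tau> / (1 - \<tau> * \<rho>)\<^sup>2) has_real_derivative
      (2 * t \<tau> * ?s\<^sup>2 - q \<tau> * (2 * ?s * (- \<rho>))) / (?s\<^sup>2 * ?s\<^sup>2)) (at \<tau>)"
      using q'[OF \<tau>] pos[OF \<tau>] by (auto intro!: derivative_eq_intros)
    have eq: "2 * t \<tau> * ?s\<^sup>2 - q \<tau> * (2 * ?s * (- \<rho>)) = 2 * ?s * (?s * t \<tau> + \<rho> * q \<tau>)"
      by (simp add: power2_eq_square algebra_simps)
    have "?s * (- t \<tau>) \<le> ?s * \<bar>t \<tau>\<bar>" using pos[OF \<tau>] by (intro mult_left_mono) auto
    then have "?s * - t \<tau> \<le> \<rho> * q \<tau>" using t[OF \<tau>] by linarith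
    then have "0 \<le> ?s * t \<tau> + \<rho> * q \<tau>" by simp
    then have "0 \<le> 2 * ?s * (?s * t \<tau> + \<rho> * q \<tau>) / (?s\<^sup>2 * ?s\<^sup>2)"
      using pos[OF \<tau>] by (intro mult_nonneg_nonneg divide_nonneg_nonneg) simp_all
    then show "\<exists>y. ((\<lambda>\<tau>. q \<tau> / (1 - \<tau> * \<rho>)\<^sup>2) has_real_derivative y) (at \<tau>) \<and> 0 \<le> y"
      using der unfolding eq by blast
  qed simp
  then show "(1 - local_norm a f x v)\<^sup>2 * B x u u \<le> B (x + v) u u"
    using pos[of 1] by (simp add: q_def \<rho>_def field_simps)
qed

end

section \<open>The majorizing scalar iteration\<close>

text \<open>This is \<open>h\<close>, with \<open>t^2 / (1 - t)\<close> expanded as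
  \<open>1 / (1 - t) - 1 - t\<close>.\<close>

definition major :: "real \<Rightarrow> real \<Rightarrow> real" where
  "major \<beta> t = \<beta> - 1 - 2 * t + 1 / (1 - t)"

text \<open>Minus the derivative of \<open>major\<close>; its zero at \<open>1 - 1 / sqrt 2\<close>
  is the origin of that radius.\<close>

definition major_slope :: "real \<Rightarrow> real" where
  "major_slope t = 2 - 1 / (1 - t)\<^sup>2"

text \<open>An exact Taylor formula: the remainder expresses convexity quantitatively, so strict
  inequalities can be extracted from it.\<close>

lemma major_tangent:
  assumes "t < 1" "s < 1"
  shows "major \<beta> s = major \<beta> t - major_slope t * (s - t) + (s - t)\<^sup>2 / ((1 - s) * (1 - t)\<^sup>2)"
proof -
  have "1 - t \<noteq> 0" "1 - s \<noteq> 0" using assms by auto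
  then show ?thesis
    unfolding major_def major_slope_def
    by (simp add: divide_simps) (simp add: algebra_simps power2_eq_square)
qed

lemma major_slope_pos: "t < 1 - 1 / sqrt 2 \<Longrightarrow> 0 < major_slope t"
proof -
  assume "t < 1 - 1 / sqrt 2"
  then have "1 / sqrt 2 < 1 - t" by simp
  then have "(1 / sqrt 2)\<^sup>2 < (1 - t)\<^sup>2" by (intro power_strict_mono) auto
  then have "1 / 2 < (1 - t)\<^sup>2" by (simp add: power_divide)
  moreover from this have "0 < (1 - t)\<^sup>2" by linarith
  ultimately show ?thesis unfolding major_slope_def by (simp add: pos_divide_less_eq)
qed

lemma major_slope_antimono: "t \<le> s \<Longrightarrow> s < 1 \<Longrightarrow> major_slope s \<le> major_slope t"
  unfolding major_slope_def by (simp add: frac_le power_mono)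

text \<open>This is p + 1/p >= 2. It allows the natural bound \<open>(1 - t)^(-2)\<close> on the
  inverse Hessian to be weakened to \<open>1 / major_slope t\<close>, which is what makes the scalar
  recursion a Newton iteration for \<open>major\<close>.\<close>

lemma major_slope_le: "t < 1 \<Longrightarrow> major_slope t \<le> (1 - t)\<^sup>2"
proof -
  assume "t < 1"
  define p where "p = (1 - t)\<^sup>2"
  have "p > 0" using \<open>t < 1\<close> by (simp add: p_def)
  moreover have "0 \<le> (p - 1)\<^sup>2" by simp
  ultimately have "2 - 1 / p \<le> p" by (simp add: field_simps power2_eq_square)
  then show ?thesis by (simp add: major_slope_def p_def)
qed

locale major_params =
  fixes \<beta> :: real
  assumes b0: "0 \<le> \<beta>" and b1: "\<beta> \<le> 3 - 2 * sqrt 2"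
begin

definition \<tau> :: real where "\<tau> = t_star \<beta>"

lemma discr_nonneg: "0 \<le> (1 + \<beta>)\<^sup>2 - 8 * \<beta>"
proof -
  have "0 \<le> (3 - 2 * sqrt 2 - \<beta>) * (3 + 2 * sqrt 2 - \<beta>)"
    using b1 by (intro mult_nonneg_nonneg) (auto intro: order_trans)
  also have "\<dots> = (1 + \<beta>)\<^sup>2 - 8 * \<beta>"
    by (simp add: algebra_simps power2_eq_square)
  finally show ?thesis .
qed

lemma d_nonneg: "0 \<le> discr_root \<beta>" using discr_nonneg by (simp add: discr_root_def)

lemma d_sq: "(discr_root \<beta>)\<^sup>2 = (1 + \<beta>)\<^sup>2 - 8 * \<beta>" using discr_nonneg by (simp add: discr_root_def)

lemma tau_eq: "4 * \<tau> = 1 + \<beta> - discr_root \<beta>" by (simp add: \<tau>_def t_star_def)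

lemma tau_root: "2 * \<tau>\<^sup>2 - (1 + \<beta>) * \<tau> + \<beta> = 0"
  using d_sq tau_eq by algebra

lemma tau_nonneg: "0 \<le> \<tau>"
proof -
  have "(discr_root \<beta>)\<^sup>2 \<le> (1 + \<beta>)\<^sup>2" using d_sq b0 by simp
  then have "discr_root \<beta> \<le> 1 + \<beta>" by (rule power2_le_imp_le) (use b0 in simp)
  then show ?thesis using tau_eq by simp
qed

lemma tau_le: "\<tau> \<le> 1 - 1 / sqrt 2"
proof -
  have "4 * \<tau> \<le> 4 - 2 * sqrt 2" using tau_eq d_nonneg b1 by simp
  moreover have "1 / sqrt 2 = sqrt 2 / 2" by (simp add: real_div_sqrt field_simps)
  ultimately show ?thesis by simp
qed

lemma tau_lt_1: "\<tau> < 1"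
  using tau_le real_sqrt_gt_zero[of 2] by (smt (verit) divide_pos_pos)

lemma major_tau: "major \<beta> \<tau> = 0"
  using tau_root tau_lt_1 unfolding major_def by (simp add: field_simps power2_eq_square)

lemma major_nonneg:
  assumes "t \<le> \<tau>"
  shows "0 \<le> major \<beta> t"
proof -
  \<comment> \<open>Factorization of the quadratic; by the sum of its roots the second factor is
    twice \<open>t_star_star \<beta> - t\<close>.\<close>
  have "major \<beta> t * (1 - t) = (\<tau> - t) * (1 + \<beta> - 2 * \<tau> - 2 * t)"
  proof -
    have "major \<beta> t * (1 - t) = 2 * t\<^sup>2 - (1 + \<beta>) * t + \<beta>"
      using tau_lt_1 assms unfolding major_def by (simp add: field_simps power2_eq_square)
    then show ?thesis using tau_root by algebra
  qed
  moreover have "0 \<le> (\<tau> - t) * (1 + \<beta> - 2 * \<tau> - 2 * t)"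
    using assms tau_eq d_nonneg by (intro mult_nonneg_nonneg) auto
  ultimately show ?thesis using tau_lt_1 assms by (metis diff_gt_0_iff_gt order_le_less_trans zero_le_mult_iff not_le)
qed

text \<open>The slope is frozen at \<open>t\<close>, with \<open>t = s\<close> in the first substep.
  It is at least the slope at \<open>s\<close>, so the step is no longer than a Newton step, which
  by convexity does not pass \<open>\<tau>\<close>. The strict third claim matters when
  \<open>\<tau> = 1 - 1 / sqrt 2\<close>: it keeps the next slope positive.\<close>

lemma major_step:
  assumes "t \<le> s" "s \<le> \<tau>" "s < 1 - 1 / sqrt 2"
  defines "u \<equiv> s + major \<beta> s / major_slope t"
  shows "s \<le> u" "u \<le> \<tau>" "u < 1 - 1 / sqrt 2"
proof -
  have s1: "s < 1" "t < 1" using assms tau_lt_1 by auto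
  have m: "0 < major_slope s" using major_slope_pos assms(3) by simp
  have mt: "major_slope s \<le> major_slope t" using major_slope_antimono[OF assms(1) s1(1)] .
  then have mt0: "0 < major_slope t" using m by simp
  show "s \<le> u" unfolding u_def using major_nonneg[OF assms(2)] mt0 by simp
  let ?q = "(\<tau> - s)\<^sup>2 / ((1 - \<tau>) * (1 - s)\<^sup>2)"
  have "major \<beta> s = major_slope s * (\<tau> - s) - ?q"
    using major_tangent[OF s1(1) tau_lt_1, of \<beta>] major_tau by simp
  moreover have "major_slope s * (\<tau> - s) \<le> major_slope t * (\<tau> - s)"
    using mt assms(2) by (intro mult_right_mono) auto
  ultimately have le: "major \<beta> s \<le> major_slope t * (\<tau> - s) - ?q" by simp
  have q: "0 \<le> ?q" using tau_lt_1 by simp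
  then have "major \<beta> s \<le> major_slope t * (\<tau> - s)" using le by linarith
  then have "major \<beta> s / major_slope t \<le> \<tau> - s" using mt0 by (simp add: field_simps)
  then show "u \<le> \<tau>" by (simp add: u_def)
  show "u < 1 - 1 / sqrt 2"
  proof (cases "s = \<tau>")
    case True
    then show ?thesis using assms major_tau by (simp add: u_def)
  next
    case False
    then have "0 < ?q" using tau_lt_1 s1 by (intro divide_pos_pos mult_pos_pos) auto
    then have "major \<beta> s < major_slope t * (\<tau> - s)" using le by linarith
    then have "major \<beta> s / major_slope t < \<tau> - s" using mt0 by (simp add: field_simps)
    then show ?thesis using tau_le by (simp add: u_def)
  qed
qed

section \<open>The scalar two-step iteration\<close>

primrec ts :: "nat \<Rightarrow> real" where
  "ts 0 = 0"
| "ts (Suc k) = ts k + major \<beta> (ts k) / major_slope (ts k)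
     + major \<beta> (ts k + major \<beta> (ts k) / major_slope (ts k)) / major_slope (ts k)"

definition ss :: "nat \<Rightarrow> real" where
  "ss k = ts k + major \<beta> (ts k) / major_slope (ts k)"

lemma ts_bounds: "0 \<le> ts k \<and> ts k \<le> \<tau> \<and> ts k < 1 - 1 / sqrt 2"
proof (induction k)
  case 0
  then show ?case using tau_nonneg by simp
next
  case (Suc k)
  then have s: "ts k \<le> ss k" "ss k \<le> \<tau>" "ss k < 1 - 1 / sqrt 2"
    using major_step[of "ts k" "ts k"] by (simp_all add: ss_def)
  then show ?case using Suc major_step[of "ts k" "ss k"] by (simp add: ss_def)
qed

lemma ss_bounds: "ts k \<le> ss k" "ss k \<le> \<tau>" "ss k < 1 - 1 / sqrt 2"
  using ts_bounds[of k] major_step[of "ts k" "ts k"] by (simp_all add: ss_def)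

lemma ts_Suc: "ts (Suc k) = ss k + major \<beta> (ss k) / major_slope (ts k)"
  by (simp add: ss_def)

lemma ts_step: "ss k \<le> ts (Suc k)"
  unfolding ts_Suc using major_step(1)[OF ss_bounds] .

lemma slope_ts_pos: "0 < major_slope (ts k)" using major_slope_pos ts_bounds by blast

lemma ts_incseq: "incseq ts"
  using ss_bounds(1) ts_step order_trans by (blast intro: incseq_SucI)

lemma ts_convergent: "convergent ts"
proof -
  have "Bseq ts"
    using ts_bounds by (intro BseqI'[of _ \<tau>]) auto
  then show ?thesis using ts_incseq Bseq_monoseq_convergent incseq_imp_monoseq by blast
qed

text \<open>The slopes are at most 1, so each value is bounded by an increment of the convergent
  sequence \<open>ts\<close>. The limit of \<open>ts\<close> need not be identified, and slopes
  tending to 0 do no harm.\<close>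

lemma major_ts_tendsto: "(\<lambda>k. major \<beta> (ts k)) \<longlonglongrightarrow> 0"
proof (rule real_tendsto_sandwich[OF _ _ tendsto_const])
  obtain l where l: "ts \<longlonglongrightarrow> l" using ts_convergent convergentD by blast
  show "(\<lambda>k. ts (Suc k) - ts k) \<longlonglongrightarrow> 0"
    using tendsto_diff[OF LIMSEQ_Suc[OF l] l] by simp
  show "\<forall>\<^sub>F k in sequentially. 0 \<le> major \<beta> (ts k)"
    using major_nonneg ts_bounds by simp
  have "major \<beta> (ts k) \<le> ts (Suc k) - ts k" for k
  proof -
    have "ts k < 1" using ts_bounds[of k] tau_lt_1 by simp
    then have "major_slope (ts k) \<le> (1 - ts k)\<^sup>2" by (rule major_slope_le)
    also have "\<dots> \<le> 1" using ts_bounds[of k] \<open>ts k < 1\<close> by (intro power_le_one) auto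
    finally have "major \<beta> (ts k) \<le> major \<beta> (ts k) / major_slope (ts k)"
      using slope_ts_pos[of k] major_nonneg[of "ts k"] ts_bounds[of k]
      mult_right_mono[of "major_slope (ts k)" 1 "major \<beta> (ts k)"] by (simp add: field_simps)
    then show ?thesis using ts_step[of k] by (simp add: ss_def)
  qed
  then show "\<forall>\<^sub>F k in sequentially. major \<beta> (ts k) \<le> ts (Suc k) - ts k" by simp
qed

text \<open>With \<open>u = 1 - \<tau>\<close> and \<open>d\<close> the discriminant root, all
  constants simplify: the slope at \<open>\<tau>\<close> is \<open>d / u\<close>,
  \<open>H_star\<close> becomes \<open>- 2 / (d * u^2)\<close>, and \<open>q_const\<close> becomes
  \<open>(1 + z) / (1 - z)\<close>. Everything then rests on \<open>2 * u^3 > 1\<close>.\<close>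

lemma
  assumes "0 < \<beta>" and b: "\<beta> < 3 - root 3 2 - root 3 4"
  shows tau_lt_r0: "\<tau> < 1 - 1 / sqrt 2"
    and H_star_eq: "H_star \<beta> = - (2 / (1 - \<tau>) ^ 3 / major_slope \<tau>)"
    and q_const_ge: "1 + 2 / (1 - \<tau>) ^ 3 / major_slope \<tau> * \<tau> / 2 \<le> q_const \<beta>"
proof -
  define u where "u = 1 - \<tau>"
  define d where "d = discr_root \<beta>"
  have u1: "1 / sqrt 2 \<le> u" "u \<le> 1" using tau_le tau_nonneg by (auto simp: u_def)
  have u0: "u > 0" using tau_lt_1 by (simp add: u_def)
  have beta: "(3 - \<beta>) * u = 2 * u\<^sup>2 + 1"
    using tau_root unfolding u_def by algebra
  define c where "c = root 3 2"
  have c3: "c ^ 3 = 2" by (simp add: c_def)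
  have c0: "c > 0" by (simp add: c_def)
  have "root 3 4 = root 3 2 * root 3 2" by (simp flip: real_root_mult)
  then have b': "c + c\<^sup>2 < 3 - \<beta>" using b by (simp add: c_def power2_eq_square)
  have c2: "c \<le> 2 * u"
  proof -
    have "c ^ 3 \<le> sqrt 2 ^ 3"
      unfolding c3 using real_sqrt_ge_1_iff[of 2] by (simp add: power3_eq_cube)
    then have "c \<le> sqrt 2" using c0 by (simp add: power_mono_iff)
    moreover have "2 * (1 / sqrt 2) = sqrt (2 :: real)" by (simp add: real_div_sqrt)
    ultimately show ?thesis using u1(1) by linarith
  qed
  \<comment> \<open>The equation \<open>beta\<close> reads 3 - \<beta> = 2u + 1/u, and at u = 1/c
    the right side equals c + c^2 because 2 = c^3. It increases for u >= 1 / sqrt 2, so the bound on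
    \<beta> forces u > 1/c; the product of the two factors below replaces the monotonicity
    argument.\<close>
  have "1 / c < u"
  proof (rule ccontr)
    assume "\<not> ?thesis"
    then have "c * u \<le> 1" using c0 by (simp add: field_simps not_less)
    then have "0 \<le> (1 - c * u) * (2 * u - c)" using c2 by simp
    moreover have "c * ((c + c\<^sup>2) * u) = c\<^sup>2 * u + 2 * u"
      unfolding c3[symmetric] by (simp add: algebra_simps power2_eq_square power3_eq_cube)
    then have "c\<^sup>2 * u + 2 * u < c * (2 * u\<^sup>2 + 1)"
      using mult_strict_left_mono[OF mult_strict_right_mono[OF b' u0] c0] by (simp only: beta)
    ultimately show False by (simp add: algebra_simps power2_eq_square)
  qed
  then have "1 < c * u" using c0 by (simp add: field_simps)
  then have "1 ^ 3 < (c * u) ^ 3" by (intro power_strict_mono) auto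
  then have u3: "1 < 2 * u ^ 3" by (simp add: power_mult_distrib c3)
  have "u ^ 3 \<le> u\<^sup>2" using u0 u1 by (intro power_decreasing) auto
  then have u2: "1 < 2 * u\<^sup>2" using u3 by linarith
  have "(1 / sqrt 2)\<^sup>2 < u\<^sup>2" using u2 by (simp add: power_divide)
  then have "1 / sqrt 2 < u" using u0 power2_less_imp_less by fastforce
  then show "\<tau> < 1 - 1 / sqrt 2" by (simp add: u_def)
  have d1: "3 - \<beta> + d = 4 * u" and d2: "1 + \<beta> - d = 4 * (1 - u)"
    using tau_eq by (auto simp: u_def d_def)
  have du: "d * u = 2 * u\<^sup>2 - 1" using beta d1 by algebra
  have d0: "d > 0" using du u2 u0 by (metis diff_gt_0_iff_gt zero_less_mult_pos2)
  have sl: "major_slope \<tau> = d / u"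
  proof -
    have "d / u = (2 * u\<^sup>2 - 1) / u\<^sup>2" unfolding du[symmetric] using u0 by (simp add: power2_eq_square)
    then show ?thesis using u0 by (simp add: major_slope_def diff_divide_distrib flip: u_def)
  qed
  have k: "2 / (1 - \<tau>) ^ 3 / major_slope \<tau> = 2 / (d * u\<^sup>2)"
    unfolding sl u_def[symmetric] using u0 d0 by (simp add: field_simps power2_eq_square power3_eq_cube)
  show "H_star \<beta> = - (2 / (1 - \<tau>) ^ 3 / major_slope \<tau>)"
    unfolding k H_star_def d_def[symmetric] d1 using u0 d0 by (simp add: power_mult_distrib)
  define z where "z = (1 - u) / (d * u\<^sup>2)"
  have "1 - u < d * u\<^sup>2"
  proof -
    have "d * u\<^sup>2 = (2 * u\<^sup>2 - 1) * u" using du by algebra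
    then show ?thesis using u3 by (simp add: algebra_simps power2_eq_square power3_eq_cube)
  qed
  then have z: "0 \<le> z" "z < 1" using u1 u0 d0 by (auto simp: z_def field_simps)
  have "q_const \<beta> = (d * (4 * u)\<^sup>2 + 4 * (4 * (1 - u))) / (d * (4 * u)\<^sup>2 - 4 * (4 * (1 - u)))"
    unfolding q_const_def d_def[symmetric] d1 d2 ..
  also have "\<dots> = (16 * (d * u\<^sup>2 + (1 - u))) / (16 * (d * u\<^sup>2 - (1 - u)))"
    by (simp add: power_mult_distrib algebra_simps)
  also have "\<dots> = (d * u\<^sup>2 + (1 - u)) / (d * u\<^sup>2 - (1 - u))" by (rule mult_divide_mult_cancel_left) simp
  also have "\<dots> = (1 + z) / (1 - z)"
    using u0 d0 \<open>1 - u < d * u\<^sup>2\<close> by (simp add: z_def divide_simps)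
  finally have q: "q_const \<beta> = (1 + z) / (1 - z)" .
  have "1 + z \<le> (1 + z) / (1 - z)" using z by (simp add: le_divide_eq mult_left_le)
  moreover have "2 / (1 - \<tau>) ^ 3 / major_slope \<tau> * \<tau> / 2 = z"
    unfolding k by (simp add: z_def u_def)
  ultimately show "1 + 2 / (1 - \<tau>) ^ 3 / major_slope \<tau> * \<tau> / 2 \<le> q_const \<beta>"
    by (simp add: q)
qed

end

section \<open>Estimates in the local norm at the initial point\<close>

lemma invertible_matrix_inv:
  fixes M :: "real ^ 'n ^ 'n"
  assumes "invertible M"
  shows "matrix_inv M ** M = mat 1" "M ** matrix_inv M = mat 1"
  using assms someI_ex[of "\<lambda>A'. M ** A' = mat 1 \<and> A' ** M = mat 1"]
  unfolding invertible_def matrix_inv_def by auto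

locale self_concordant_at = self_concordant +
  fixes x0
  assumes x0: "x0 \<in> D" and inv0: "invertible (hess f x0)"
begin

sublocale semi_inner "B x0" by (rule semi_inner_B[OF x0])

lemma local_norm_eq_N: "local_norm a f x0 = N"
  using N_local_norm[OF x0] by simp

text \<open>By Cauchy-Schwarz a null vector of the seminorm is orthogonal to everything, hence in
  the kernel of the nonsingular matrix \<open>hess f x0\<close>.\<close>

lemma N_pos:
  assumes "u \<noteq> 0"
  shows "0 < N u"
proof (rule ccontr)
  assume "\<not> ?thesis"
  then have "N u = 0" using N_nonneg[of u] by simp
  then have "B x0 u w = 0" for w using cauchy_schwarz[of u w] by simp
  from this[of "hess f x0 *v u"] have "hess f x0 *v u = 0" using a by (simp add: local_inner_def)
  then have "matrix_inv (hess f x0) *v (hess f x0 *v u) = 0" by simp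
  then show False using assms invertible_matrix_inv[OF inv0] by (simp add: matrix_vector_mul_assoc)
qed

lemma N_continuous: "continuous_on UNIV N"
  unfolding local_norm_eq_N[symmetric] local_norm_def local_inner_def
  by (intro continuous_intros continuous_on_real_sqrt matrix_vector_mult_linear_continuous_on)

lemma norm_le_N: obtains c where "0 < c" "\<And>u. c * norm u \<le> N u"
proof -
  have "compact (sphere (0 :: real ^ 'a) 1)" "sphere (0 :: real ^ 'a) 1 \<noteq> {}" by auto
  then obtain u0 where u0: "norm u0 = 1" "\<And>u. norm u = 1 \<Longrightarrow> N u0 \<le> N u"
    using continuous_attains_inf[of "sphere 0 1" N] continuous_on_subset[OF N_continuous] by auto
  have "N u0 * norm u \<le> N u" for u
  proof (cases "u = 0")
    case False
    then have "N u0 \<le> N ((1 / norm u) *\<^sub>R u)" by (intro u0(2)) simp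
    then show ?thesis using False unfolding N_scale by (simp add: field_simps)
  qed simp
  moreover have "0 < N u0" using u0(1) by (intro N_pos) auto
  ultimately show thesis using that by blast
qed

lemma hess_lower: 
  assumes "x \<in> D" "N (x - x0) \<le> t" "t < 1"
  shows "(1 - t)\<^sup>2 * (N u)\<^sup>2 \<le> B x u u"
proof -
  have "(1 - t)\<^sup>2 * (N u)\<^sup>2 \<le> (1 - N (x - x0))\<^sup>2 * (N u)\<^sup>2"
    using assms by (intro mult_right_mono power_mono) auto
  also have "\<dots> \<le> B x u u"
    using hess_comparison(1)[of x0 "x - x0" u] assms x0 by (simp add: N_sq local_norm_eq_N)
  finally show ?thesis .
qed

lemma local_norm_upper:
  assumes "x \<in> D" "N (x - x0) \<le> t" "t < 1"
  shows "local_norm a f x u \<le> N u / (1 - t)"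
proof -
  have "(1 - t)\<^sup>2 * B x u u \<le> (1 - N (x - x0))\<^sup>2 * B x u u"
    using assms B_nonneg by (intro mult_right_mono power_mono) auto
  also have "\<dots> \<le> (N u)\<^sup>2"
    using hess_comparison(2)[of x0 "x - x0" u] assms x0 by (simp add: N_sq local_norm_eq_N)
  finally have "((1 - t) * local_norm a f x u)\<^sup>2 \<le> (N u)\<^sup>2"
    using B_nonneg[OF assms(1), of u] by (simp add: power_mult_distrib local_norm_def)
  then have "(1 - t) * local_norm a f x u \<le> N u" by (rule power2_le_imp_le) simp
  then show ?thesis using assms(3) by (simp add: field_simps)
qed

lemma third_bound:
  assumes "x \<in> D" "N (x - x0) \<le> t" "t < 1"
  shows "\<bar>T x u v w\<bar> \<le> N u * N v * N w / (1 - t) ^ 3"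
proof -
  have n: "0 \<le> local_norm a f x z" for z
    using B_nonneg[OF assms(1)] by (simp add: local_norm_def)
  have "\<bar>T x u v w\<bar> \<le> local_norm a f x u * local_norm a f x v * local_norm a f x w"
    by (rule T_bound[OF assms(1)])
  also have "\<dots> \<le> (N u / (1 - t)) * (N v / (1 - t)) * (N w / (1 - t))"
    using n assms by (intro mult_mono local_norm_upper mult_nonneg_nonneg) auto
  finally show ?thesis by (simp add: power3_eq_cube)
qed

section \<open>Variation of the Hessian and Taylor remainders of the gradient\<close>

text \<open>A mean value inequality with a scalar majorant \<open>\<psi>\<close>. The radius bound
  \<open>r\<close> is kept general for two uses: affine \<open>r\<close> produces differences of the
  derivative of \<open>major\<close>, constant \<open>r\<close> a Lipschitz bound.\<close>

lemma hess_difference: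
  assumes D: "x \<in> D" "x + v \<in> D"
    and r: "\<And>\<tau>. 0 \<le> \<tau> \<Longrightarrow> \<tau> \<le> 1 \<Longrightarrow> N (x + \<tau> *\<^sub>R v - x0) \<le> r \<tau> \<and> r \<tau> < 1"
    and \<psi>: "\<And>\<tau>. 0 \<le> \<tau> \<Longrightarrow> \<tau> \<le> 1 \<Longrightarrow> (\<psi> has_real_derivative \<psi>' \<tau>) (at \<tau>)"
    and \<psi>': "\<And>\<tau>. 0 \<le> \<tau> \<Longrightarrow> \<tau> \<le> 1 \<Longrightarrow> 2 * N v / (1 - r \<tau>) ^ 3 \<le> \<psi>' \<tau>"
  shows "\<bar>B (x + v) u w - B x u w\<bar> \<le> (\<psi> 1 - \<psi> 0) * (N u * N w)"
proof -
  have one_sided: "B (x + v) u w - B x u w \<le> (\<psi> 1 - \<psi> 0) * (N u * N w)" for u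
  proof -
    let ?F = "\<lambda>\<tau>. B (x + \<tau> *\<^sub>R v) u w - \<psi> \<tau> * (N u * N w)"
    have "?F 1 \<le> ?F 0"
    proof (rule DERIV_nonpos_imp_nonincreasing[of 0 1 ?F])
      fix \<tau> :: real assume \<tau>: "0 \<le> \<tau>" "\<tau> \<le> 1"
      note mem = segment_in_D[OF D \<tau>]
      have "(?F has_real_derivative 2 * T (x + \<tau> *\<^sub>R v) v u w - \<psi>' \<tau> * (N u * N w)) (at \<tau>)"
        by (intro DERIV_diff B_line_deriv[OF mem] DERIV_cmult_right \<psi>[OF \<tau>])
      moreover have "T (x + \<tau> *\<^sub>R v) v u w \<le> N v * N u * N w / (1 - r \<tau>) ^ 3"
        using third_bound[OF mem, of "r \<tau>" v u w] r[OF \<tau>] by simp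
      then have "2 * T (x + \<tau> *\<^sub>R v) v u w \<le> 2 * N v / (1 - r \<tau>) ^ 3 * (N u * N w)" by simp
      then have "2 * T (x + \<tau> *\<^sub>R v) v u w \<le> \<psi>' \<tau> * (N u * N w)"
        using mult_right_mono[OF \<psi>'[OF \<tau>], of "N u * N w"] by simp
      ultimately show "\<exists>y. (?F has_real_derivative y) (at \<tau>) \<and> y \<le> 0" 
        by (intro exI[of _ "2 * T (x + \<tau> *\<^sub>R v) v u w - \<psi>' \<tau> * (N u * N w)"]) simp
    qed simp
    then show ?thesis by (simp add: left_diff_distrib)
  qed
  \<comment> \<open>Replacing \<open>u\<close> by \<open>- u\<close> turns the one-sided estimate
    into one for the absolute value.\<close>
  have "B (x + v) (- u) w = - B (x + v) u w" "B x (- u) w = - B x u w"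
    using semi_inner.left(4)[OF semi_inner_B] D by auto
  then show ?thesis using one_sided[of u] one_sided[of "- u"] by simp
qed

lemma hess_difference_major:
  assumes D: "x \<in> D" "z \<in> D" and t: "N (x - x0) \<le> t" and d: "N (z - x) \<le> d" "t + d < 1"
  shows "\<bar>B z u w - B x u w\<bar> \<le> (1 / (1 - t - d)\<^sup>2 - 1 / (1 - t)\<^sup>2) * (N u * N w)"
proof -
  have d0: "0 \<le> d" using d(1) N_nonneg order_trans by blast
  have pos: "1 - t - \<tau> * d > 0" if "0 \<le> \<tau>" "\<tau> \<le> 1" for \<tau>
    using that d(2) d0 mult_right_mono[of \<tau> 1 d] by simp
  have "\<bar>B (x + (z - x)) u w - B x u w\<bar> \<le> (1 / (1 - t - 1 * d)\<^sup>2 - 1 / (1 - t - 0 * d)\<^sup>2) * (N u * N w)"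
  proof (rule hess_difference[where r = "\<lambda>\<tau>. t + \<tau> * d" and \<psi>' = "\<lambda>\<tau>. 2 * d / (1 - t - \<tau> * d) ^ 3"])
    fix \<tau> :: real assume \<tau>: "0 \<le> \<tau>" "\<tau> \<le> 1"
    have "N (x + \<tau> *\<^sub>R (z - x) - x0) \<le> N (\<tau> *\<^sub>R (z - x)) + N (x - x0)"
      using N_triangle[of "\<tau> *\<^sub>R (z - x)" "x - x0"] by (simp add: algebra_simps)
    also have "\<dots> \<le> \<tau> * d + t"
      unfolding N_scale using \<tau> d t by (intro add_mono mult_mono) auto
    finally show "N (x + \<tau> *\<^sub>R (z - x) - x0) \<le> t + \<tau> * d \<and> t + \<tau> * d < 1" using pos[OF \<tau>] by simp
    show "((\<lambda>\<tau>. 1 / (1 - t - \<tau> * d)\<^sup>2) has_real_derivative 2 * d / (1 - t - \<tau> * d) ^ 3) (at \<tau>)"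
      using pos[OF \<tau>]
      by (auto intro!: derivative_eq_intros) (simp add: divide_simps power2_eq_square power3_eq_cube power4_eq_xxxx)
    show "2 * N (z - x) / (1 - (t + \<tau> * d)) ^ 3 \<le> 2 * d / (1 - t - \<tau> * d) ^ 3"
      using pos[OF \<tau>] d by (simp add: divide_right_mono algebra_simps)
  qed (use D in auto)
  then show ?thesis by simp
qed

lemma N_segment:
  assumes "0 \<le> \<tau>" "\<tau> \<le> 1"
  shows "N (p + \<tau> *\<^sub>R (q - p) - c) \<le> (1 - \<tau>) * N (p - c) + \<tau> * N (q - c)"
proof -
  have "p + \<tau> *\<^sub>R (q - p) - c = (1 - \<tau>) *\<^sub>R (p - c) + \<tau> *\<^sub>R (q - c)" by (simp add: algebra_simps)
  then show ?thesis using N_triangle[of "(1 - \<tau>) *\<^sub>R (p - c)" "\<tau> *\<^sub>R (q - c)"] assms by (simp add: N_scale)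
qed

lemma N_segment_le:
  assumes "0 \<le> \<tau>" "\<tau> \<le> 1" "N (p - c) \<le> R" "N (q - c) \<le> R"
  shows "N (p + \<tau> *\<^sub>R (q - p) - c) \<le> R"
proof -
  have "(1 - \<tau>) * N (p - c) + \<tau> * N (q - c) \<le> (1 - \<tau>) * R + \<tau> * R"
    using assms by (intro add_mono mult_left_mono) auto
  then show ?thesis using N_segment[OF assms(1,2), of p q c] by (simp add: algebra_simps)
qed

lemma hess_difference_lipschitz:
  assumes D: "x \<in> D" "z \<in> D" and R: "N (x - x0) \<le> R" "N (z - x0) \<le> R" "R < 1"
  shows "\<bar>B z u w - B x u w\<bar> \<le> 2 / (1 - R) ^ 3 * N (z - x) * (N u * N w)"
proof -
  define L where "L = 2 / (1 - R) ^ 3 * N (z - x)"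
  have "\<bar>B (x + (z - x)) u w - B x u w\<bar> \<le> (L * 1 - L * 0) * (N u * N w)"
  proof (rule hess_difference[where r = "\<lambda>_. R" and \<psi>' = "\<lambda>_. L"])
    fix \<tau> :: real assume \<tau>: "0 \<le> \<tau>" "\<tau> \<le> 1"
    show "N (x + \<tau> *\<^sub>R (z - x) - x0) \<le> R \<and> R < 1" using N_segment_le[OF \<tau> R(1,2)] R by simp
    show "2 * N (z - x) / (1 - R) ^ 3 \<le> L" by (simp add: L_def)
    show "((\<lambda>\<tau>. L * \<tau>) has_real_derivative L) (at \<tau>)"
      by (auto intro!: derivative_eq_intros)
  qed (use D in auto)
  then show ?thesis by (simp add: L_def)
qed

text \<open>The linearization at \<open>p\<close> uses the Hessian at another point
  \<open>x\<close>, as in the second substep, where the matrix of \<open>x k\<close> is reused at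
  \<open>y k\<close>.\<close>

lemma residual_bound:
  assumes D: "p \<in> D" "q \<in> D"
    and \<Psi>: "\<And>\<tau>. 0 \<le> \<tau> \<Longrightarrow> \<tau> \<le> 1 \<Longrightarrow> (\<Psi> has_real_derivative \<Psi>' \<tau>) (at \<tau>)"
    and \<Psi>': "\<And>\<tau> w. 0 \<le> \<tau> \<Longrightarrow> \<tau> \<le> 1 \<Longrightarrow>
      \<bar>B (p + \<tau> *\<^sub>R (q - p)) (q - p) w - B x (q - p) w\<bar> \<le> \<Psi>' \<tau> * N w"
    and x: "x \<in> D"
  shows "\<bar>G q w - G p w - B x (q - p) w\<bar> \<le> (\<Psi> 1 - \<Psi> 0) * N w"
proof -
  have one_sided: "G q w - G p w - B x (q - p) w \<le> (\<Psi> 1 - \<Psi> 0) * N w" for w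
  proof -
    let ?F = "\<lambda>\<tau>. G (p + \<tau> *\<^sub>R (q - p)) w - \<tau> * B x (q - p) w - \<Psi> \<tau> * N w"
    have "?F 1 \<le> ?F 0"
    proof (rule DERIV_nonpos_imp_nonincreasing[of 0 1 ?F])
      fix \<tau> :: real assume \<tau>: "0 \<le> \<tau>" "\<tau> \<le> 1"
      have mem: "p + \<tau> *\<^sub>R (q - p) \<in> D" using segment_in_D[of p "q - p"] D \<tau> by simp
      let ?y = "B (p + \<tau> *\<^sub>R (q - p)) (q - p) w - 1 * B x (q - p) w - \<Psi>' \<tau> * N w"
      have "(?F has_real_derivative ?y) (at \<tau>)"
        by (intro DERIV_diff G_line_deriv[OF mem] DERIV_cmult_right \<Psi>[OF \<tau>] DERIV_ident)
      moreover have "?y \<le> 0" using \<Psi>'[OF \<tau>, of w] by simp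
      ultimately show "\<exists>y. (?F has_real_derivative y) (at \<tau>) \<and> y \<le> 0" by blast
    qed simp
    then show ?thesis by (simp add: left_diff_distrib)
  qed
  have "G q (- w) = - G q w" "G p (- w) = - G p w" "B x (q - p) (- w) = - B x (q - p) w"
    using semi_inner.right(4)[OF semi_inner_B[OF x]] by (auto simp: G_def)
  then show ?thesis using one_sided[of w] one_sided[of "- w"] by simp
qed

text \<open>The bound is exactly \<open>h(u) - h(s) - h'(t) * (u - s)\<close>, the same remainder
  for the scalar function; it arises by integrating \<open>hess_difference_major\<close> along the
  segment.\<close>

lemma residual_major:
  assumes D: "x \<in> D" "p \<in> D" "q \<in> D"
    and t: "N (x - x0) \<le> t" "N (p - x) \<le> s - t" "N (q - p) \<le> u - s" "u < 1"
  shows "\<bar>G q w - G p w - B x (q - p) w\<bar> \<le> (1 / (1 - u) - 1 / (1 - s) - (u - s) / (1 - t)\<^sup>2) * N w"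
proof -
  have ord: "t \<le> s" "s \<le> u" using t N_nonneg[of "p - x"] N_nonneg[of "q - p"] by linarith+
  have pos: "1 - s - \<tau> * (u - s) > 0" if "0 \<le> \<tau>" "\<tau> \<le> 1" for \<tau>
    using that ord t(4) mult_right_mono[of \<tau> 1 "u - s"] by simp
  define c where "c = (u - s) / (1 - t)\<^sup>2"
  let ?\<Psi> = "\<lambda>\<tau>. 1 / (1 - s - \<tau> * (u - s)) - \<tau> * c"
  let ?\<Psi>' = "\<lambda>\<tau>. (1 / (1 - s - \<tau> * (u - s))\<^sup>2 - 1 / (1 - t)\<^sup>2) * (u - s)"
  have "\<bar>G q w - G p w - B x (q - p) w\<bar> \<le> (?\<Psi> 1 - ?\<Psi> 0) * N w"
  proof (rule residual_bound[OF D(2,3) _ _ D(1), of ?\<Psi> ?\<Psi>'])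
    fix \<tau> :: real assume \<tau>: "0 \<le> \<tau>" "\<tau> \<le> 1"
    show "(?\<Psi> has_real_derivative ?\<Psi>' \<tau>) (at \<tau>)"
    proof -
      have "(?\<Psi> has_real_derivative (u - s) / (1 - s - \<tau> * (u - s))\<^sup>2 - c) (at \<tau>)"
        using pos[OF \<tau>] by (auto intro!: derivative_eq_intros simp: power2_eq_square)
      then show ?thesis by (simp add: c_def left_diff_distrib)
    qed
    fix w
    let ?z = "p + \<tau> *\<^sub>R (q - p)"
    have mem: "?z \<in> D" using segment_in_D[of p "q - p"] D \<tau> by simp
    have "N (?z - x) \<le> N (p - x) + N (\<tau> *\<^sub>R (q - p))"
      using N_triangle[of "p - x" "\<tau> *\<^sub>R (q - p)"] by (simp add: algebra_simps)
    also have "\<dots> \<le> (s - t) + \<tau> * (u - s)"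
      unfolding N_scale using \<tau> t by (intro add_mono mult_mono) auto
    finally have z: "N (?z - x) \<le> s - t + \<tau> * (u - s)" .
    have "\<bar>B ?z (q - p) w - B x (q - p) w\<bar>
        \<le> (1 / (1 - t - (s - t + \<tau> * (u - s)))\<^sup>2 - 1 / (1 - t)\<^sup>2) * (N (q - p) * N w)"
      using hess_difference_major[OF D(1) mem t(1) z] pos[OF \<tau>] by simp
    also have "1 - t - (s - t + \<tau> * (u - s)) = 1 - s - \<tau> * (u - s)" by simp
    also have "(1 / (1 - s - \<tau> * (u - s))\<^sup>2 - 1 / (1 - t)\<^sup>2) * (N (q - p) * N w) \<le> ?\<Psi>' \<tau> * N w"
    proof -
      have "1 - s - \<tau> * (u - s) \<le> 1 - t" using ord mult_nonneg_nonneg[of \<tau> "u - s"] \<tau> by linarith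
      then have "(1 - s - \<tau> * (u - s))\<^sup>2 \<le> (1 - t)\<^sup>2" using pos[OF \<tau>] by (intro power_mono) auto
      then have "0 \<le> 1 / (1 - s - \<tau> * (u - s))\<^sup>2 - 1 / (1 - t)\<^sup>2"
        using pos[OF \<tau>] by (simp add: frac_le)
      then show ?thesis unfolding mult.assoc using t(3) by (intro mult_left_mono mult_right_mono) auto
    qed
    finally show "\<bar>B ?z (q - p) w - B x (q - p) w\<bar> \<le> ?\<Psi>' \<tau> * N w" .
  qed
  moreover have "?\<Psi> 1 - ?\<Psi> 0 = 1 / (1 - u) - 1 / (1 - s) - (u - s) / (1 - t)\<^sup>2" by (simp add: c_def)
  ultimately show ?thesis by (simp only:)
qed

text \<open>The distance to \<open>x\<close> along the segment is at most the linear interpolation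
  of its end values, whose integral is their mean. For \<open>p = x\<close> this is the usual factor
  1/2.\<close>

lemma residual_lipschitz:
  assumes D: "x \<in> D" "p \<in> D" "q \<in> D"
    and R: "N (x - x0) \<le> R" "N (p - x0) \<le> R" "N (q - x0) \<le> R" "R < 1"
  shows "\<bar>G q w - G p w - B x (q - p) w\<bar>
    \<le> 2 / (1 - R) ^ 3 * ((N (p - x) + N (q - x)) / 2) * N (q - p) * N w"
proof -
  define K where "K = 2 / (1 - R) ^ 3 * N (q - p)"
  let ?\<Psi> = "\<lambda>\<tau>. K * (\<tau> * N (p - x) + \<tau>\<^sup>2 / 2 * (N (q - x) - N (p - x)))"
  let ?\<Psi>' = "\<lambda>\<tau>. K * (N (p - x) + \<tau> * (N (q - x) - N (p - x)))"
  have "\<bar>G q w - G p w - B x (q - p) w\<bar> \<le> (?\<Psi> 1 - ?\<Psi> 0) * N w"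
  proof (rule residual_bound[OF D(2,3) _ _ D(1), of ?\<Psi> ?\<Psi>'])
    fix \<tau> :: real assume \<tau>: "0 \<le> \<tau>" "\<tau> \<le> 1"
    show "(?\<Psi> has_real_derivative ?\<Psi>' \<tau>) (at \<tau>)"
      by (auto intro!: derivative_eq_intros)
    fix w
    let ?z = "p + \<tau> *\<^sub>R (q - p)"
    have mem: "?z \<in> D" using segment_in_D[of p "q - p"] D \<tau> by simp
    have "\<bar>B ?z (q - p) w - B x (q - p) w\<bar> \<le> 2 / (1 - R) ^ 3 * N (?z - x) * (N (q - p) * N w)"
      using hess_difference_lipschitz[OF D(1) mem R(1) N_segment_le[OF \<tau> R(2,3)] R(4)] .
    also have "\<dots> \<le> 2 / (1 - R) ^ 3 * ((1 - \<tau>) * N (p - x) + \<tau> * N (q - x)) * (N (q - p) * N w)"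
      using N_segment[OF \<tau>] R(4) by (intro mult_left_mono mult_right_mono) auto
    also have "\<dots> = ?\<Psi>' \<tau> * N w" by (simp add: K_def algebra_simps add_divide_distrib)
    finally show "\<bar>B ?z (q - p) w - B x (q - p) w\<bar> \<le> ?\<Psi>' \<tau> * N w" .
  qed
  moreover have "?\<Psi> 1 - ?\<Psi> 0 = 2 / (1 - R) ^ 3 * ((N (p - x) + N (q - x)) / 2) * N (q - p)"
    by (simp add: K_def field_simps)
  ultimately show ?thesis by simp
qed

text \<open>Testing with \<open>w = u\<close> bounds the solution by the lower Hessian estimate
  alone. For \<open>N u = 0\<close> the remaining claim \<open>0 \<le> c\<close> needs some nonzero
  test vector.\<close>

lemma solve_bound:
  assumes "x \<in> D" "N (x - x0) \<le> t" "t < 1" and B: "\<And>w. \<bar>B x u w\<bar> \<le> c * N w"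
  shows "(1 - t)\<^sup>2 * N u \<le> c"
proof (cases "N u = 0")
  case True
  have "0 \<le> c"
  proof (rule ccontr)
    assume "\<not> 0 \<le> c"
    obtain w :: "real ^ 'a" where "w \<noteq> 0" by (metis vec_eq_iff zero_index one_index zero_neq_one)
    then have "c * N w < 0" using \<open>\<not> 0 \<le> c\<close> N_pos[of w] by (simp add: mult_neg_pos)
    then show False using B[of w] by linarith
  qed
  then show ?thesis using True by simp
next
  case False
  then have "N u > 0" using N_nonneg[of u] by (simp add: less_le)
  moreover have "((1 - t)\<^sup>2 * N u) * N u \<le> c * N u"
    using hess_lower[OF assms(1-3), of u] B[of u] by (simp add: power2_eq_square mult.assoc)
  ultimately show ?thesis by simp
qed

lemma hess_invertible:
  assumes "x \<in> D" "N (x - x0) < 1"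
  shows "invertible (hess f x)"
proof -
  have "u = 0" if "hess f x *v u = 0" for u
  proof (rule ccontr)
    assume "u \<noteq> 0"
    then have "0 < (1 - N (x - x0))\<^sup>2 * (N u)\<^sup>2" using N_pos[OF \<open>u \<noteq> 0\<close>] assms(2) by simp
    then show False using hess_lower[OF assms(1) order_refl assms(2), of u] that by (simp add: local_inner_def)
  qed
  then show ?thesis
    using matrix_left_invertible_ker[of "hess f x"] invertible_left_inverse by blast
qed

lemma newton_step:
  assumes "invertible (hess f x)" "y = z - matrix_inv (hess f x) *v grad f p"
  shows "B x (y - z) w = - G p w"
proof -
  have "hess f x *v (y - z) = - (hess f x *v (matrix_inv (hess f x) *v grad f p))"
    using assms(2) by (simp add: linear_neg[OF matrix_vector_mul_linear])
  then show ?thesis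
    using invertible_matrix_inv(2)[OF assms(1)] by (simp add: local_inner_def G_def matrix_vector_mul_assoc)
qed

end

section \<open>The two-step Newton iteration\<close>

locale two_step_newton = self_concordant_at + major_params +
  fixes x y :: "nat \<Rightarrow> real ^ 'a"
  assumes ball: "local_ball a f x0 (1 - 1 / sqrt 2) \<subseteq> D"
    and x_0: "x 0 = x0"
    and y_eq: "y k = x k - matrix_inv (hess f (x k)) *v grad f (x k)"
    and x_Suc: "x (Suc k) = y k - matrix_inv (hess f (x k)) *v grad f (y k)"
    and \<beta>_eq: "\<beta> = N (matrix_inv (hess f x0) *v grad f x0)"
begin

section \<open>Majorization of the iterates\<close>

lemma in_D: "N (z - x0) < 1 - 1 / sqrt 2 \<Longrightarrow> z \<in> D"
  using ball by (auto simp: local_ball_def local_norm_eq_N)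

lemma G_x0: "\<bar>G x0 w\<bar> \<le> \<beta> * N w"
proof -
  have "G x0 w = B x0 (matrix_inv (hess f x0) *v grad f x0) w"
    using invertible_matrix_inv(2)[OF inv0]
    by (simp add: G_def local_inner_def matrix_vector_mul_assoc)
  then show ?thesis unfolding \<beta>_eq using cauchy_schwarz by simp
qed

lemma newton_bound:
  assumes z: "z \<in> D" "N (z - x0) \<le> t" "t < 1 - 1 / sqrt 2"
    and B: "\<And>w. \<bar>B z u w\<bar> \<le> c * N w"
  shows "N u \<le> c / major_slope t"
proof -
  have t1: "t < 1" using z(3) by (smt (verit) divide_pos_pos real_sqrt_gt_zero)
  have "major_slope t * N u \<le> (1 - t)\<^sup>2 * N u"
    using major_slope_le[OF t1] by (intro mult_right_mono) auto
  also have "\<dots> \<le> c" using solve_bound[OF z(1,2) t1 B] .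
  finally show ?thesis using major_slope_pos[OF z(3)] by (simp add: field_simps)
qed

text \<open>The vector step and the scalar step both solve their linearized equations, so the linear
  parts cancel and the scalar remainder collapses to \<open>major \<beta> u\<close>.\<close>

lemma residual_major':
  assumes D: "z \<in> D" "p \<in> D" "q \<in> D"
    and t: "N (z - x0) \<le> t" "N (p - z) \<le> s - t" "N (q - p) \<le> u - s" "u < 1"
    and B: "\<And>w. B z (q - p) w = - G p w" and u: "major \<beta> s = major_slope t * (u - s)"
  shows "\<bar>G q w\<bar> \<le> major \<beta> u * N w"
proof -
  have "1 / (1 - u) - 1 / (1 - s) - (u - s) / (1 - t)\<^sup>2 = major \<beta> u - major \<beta> s + major_slope t * (u - s)"
    unfolding major_def major_slope_def by (simp add: algebra_simps)
  then show ?thesis using residual_major[OF D t, of w] B u by simp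
qed

text \<open>The substep to \<open>y k\<close> uses the scalar points \<open>t = s = ts k\<close>,
  the one to \<open>x (Suc k)\<close> uses \<open>s = ss k\<close> with the slope still at
  \<open>ts k\<close>. Membership in \<open>D\<close> has to be obtained before each residual
  estimate, since the segment must lie in \<open>D\<close>.\<close>

lemma invariant_step:
  assumes "x k \<in> D" "N (x k - x0) \<le> ts k" and G: "\<And>w. \<bar>G (x k) w\<bar> \<le> major \<beta> (ts k) * N w"
  shows "invertible (hess f (x k))" "y k \<in> D" "N (y k - x k) \<le> ss k - ts k"
    "N (x (Suc k) - y k) \<le> ts (Suc k) - ss k" "x (Suc k) \<in> D"
    "\<bar>G (x (Suc k)) w\<bar> \<le> major \<beta> (ts (Suc k)) * N w"
proof -
  have t: "ts k < 1 - 1 / sqrt 2" "ts k < 1" using ts_bounds[of k] tau_lt_1 by auto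
  show inv: "invertible (hess f (x k))"
    using hess_invertible[OF assms(1)] assms(2) t by simp
  have By: "B (x k) (y k - x k) w = - G (x k) w" for w by (rule newton_step[OF inv y_eq])
  have Bx: "B (x k) (x (Suc k) - y k) w = - G (y k) w" for w by (rule newton_step[OF inv x_Suc])
  show yx: "N (y k - x k) \<le> ss k - ts k"
    using newton_bound[OF assms(1,2) t(1), of "y k - x k"] G by (simp add: By ss_def)
  have "N (y k - x0) \<le> ss k"
    using N_triangle_diff[of "y k" x0 "x k"] yx assms(2) by linarith
  then show yD: "y k \<in> D" using ss_bounds(3)[of k] by (intro in_D) linarith
  have Gy: "\<bar>G (y k) w\<bar> \<le> major \<beta> (ss k) * N w" for w
    by (rule residual_major'[OF assms(1,1) yD assms(2) _ yx _ By])
      (use ss_bounds[of k] tau_lt_1 slope_ts_pos[of k] in \<open>auto simp: ss_def\<close>)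
  show xy: "N (x (Suc k) - y k) \<le> ts (Suc k) - ss k"
    using newton_bound[OF assms(1,2) t(1), of "x (Suc k) - y k"] Gy by (simp add: Bx ts_Suc del: ts.simps)
  have "N (x (Suc k) - x0) \<le> ts (Suc k)"
    using N_triangle_diff[of "x (Suc k)" x0 "y k"] xy \<open>N (y k - x0) \<le> ss k\<close> by linarith
  then show xD: "x (Suc k) \<in> D" using ts_bounds[of "Suc k"] by (intro in_D) linarith
  show "\<bar>G (x (Suc k)) w\<bar> \<le> major \<beta> (ts (Suc k)) * N w"
    by (rule residual_major'[OF assms(1) yD xD assms(2) yx xy _ Bx])
      (use ts_bounds[of "Suc k"] tau_lt_1 slope_ts_pos[of k] in \<open>auto simp: ts_Suc simp del: ts.simps\<close>)
qed

lemma invariant: "x k \<in> D \<and> N (x k - x0) \<le> ts k \<and> (\<forall>w. \<bar>G (x k) w\<bar> \<le> major \<beta> (ts k) * N w)"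
proof (induction k)
  case 0
  then show ?case using G_x0 x0 x_0 by (simp add: major_def)
next
  case (Suc k)
  then have prem: "x k \<in> D" "N (x k - x0) \<le> ts k" "\<And>w. \<bar>G (x k) w\<bar> \<le> major \<beta> (ts k) * N w" by auto
  note step = invariant_step[OF prem]
  have "N (x (Suc k) - x0) \<le> ts (Suc k)"
    using N_triangle_diff[of "x (Suc k)" x0 "y k"] N_triangle_diff[of "y k" x0 "x k"] step(3,4) prem(2)
    by linarith
  then show ?case using step(5,6) by blast
qed

lemma iterates:
  shows x_D: "x k \<in> D" and N_x: "N (x k - x0) \<le> ts k" and G_x: "\<bar>G (x k) w\<bar> \<le> major \<beta> (ts k) * N w"
    and inv: "invertible (hess f (x k))" and y_D: "y k \<in> D" and N_yx: "N (y k - x k) \<le> ss k - ts k"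
    and N_xy: "N (x (Suc k) - y k) \<le> ts (Suc k) - ss k"
  using invariant[of k] invariant_step[of k] by auto

lemma N_y: "N (y k - x0) \<le> ss k"
  using N_triangle_diff[of "y k" x0 "x k"] N_yx[of k] N_x[of k] by linarith

lemma N_step: "N (x (Suc k) - x k) \<le> ts (Suc k) - ts k"
  using N_triangle_diff[of "x (Suc k)" "x k" "y k"] N_yx[of k] N_xy[of k] by linarith

lemma N_steps: "m \<le> n \<Longrightarrow> N (x n - x m) \<le> ts n - ts m"
proof (induction n rule: dec_induct)
  case (step n)
  then show ?case using N_triangle_diff[of "x (Suc n)" "x m" "x n"] N_step[of n] by linarith
qed simp

section \<open>Convergence, the limit and its minimality\<close>

lemma x_Cauchy: "Cauchy x"
proof -
  obtain c where c: "0 < c" "\<And>u. c * norm u \<le> N u" using norm_le_N by blast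
  have le: "norm (x n - x m) \<le> \<bar>ts n - ts m\<bar> / c" for m n
  proof (cases "m \<le> n")
    case True
    have "c * norm (x n - x m) \<le> \<bar>ts n - ts m\<bar>" using c(2)[of "x n - x m"] N_steps[OF True] by linarith
    then show ?thesis using c(1) by (simp add: field_simps)
  next
    case False
    then have "c * norm (x m - x n) \<le> \<bar>ts n - ts m\<bar>" using c(2)[of "x m - x n"] N_steps[of n m] by linarith
    then show ?thesis using c(1) by (simp add: field_simps norm_minus_commute)
  qed
  have "Cauchy ts" using ts_convergent convergent_Cauchy by blast
  show ?thesis
  proof (rule CauchyI)
    fix e :: real assume "0 < e"
    then obtain M where M: "\<And>m n. M \<le> m \<Longrightarrow> M \<le> n \<Longrightarrow> norm (ts m - ts n) < c * e"
      using CauchyD[OF \<open>Cauchy ts\<close>, of "c * e"] c(1) by auto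
    have "norm (x m - x n) < e" if "M \<le> m" "M \<le> n" for m n
    proof -
      have "\<bar>ts m - ts n\<bar> / c < e" using M[OF that] c(1) by (simp add: field_simps)
      then show ?thesis using le[of m n] by linarith
    qed
    then show "\<exists>M. \<forall>m\<ge>M. \<forall>n\<ge>M. norm (x m - x n) < e" by blast
  qed
qed

definition xs where "xs = lim x"

lemma x_tendsto: "x \<longlonglongrightarrow> xs"
  using x_Cauchy Cauchy_convergent convergent_LIMSEQ_iff xs_def by metis

lemma N_tendsto: "(\<lambda>k. N (x k - z)) \<longlonglongrightarrow> N (xs - z)"
  using N_continuous x_tendsto
  by (intro isCont_tendsto_compose[of _ N] tendsto_intros) (auto simp: continuous_on_eq_continuous_at)

lemma error_tendsto: "(\<lambda>k. N (x k - xs)) \<longlonglongrightarrow> 0"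
  using N_tendsto[of xs] by simp

lemma N_xs: "N (xs - x0) \<le> \<tau>"
  using N_x ts_bounds order_trans by (intro LIMSEQ_le_const2[OF N_tendsto]) blast

text \<open>At \<open>\<beta> = 3 - 2 * sqrt 2\<close> the majorant only places the limit in the closed ball of radius
  \<open>1 - 1 / sqrt 2\<close>, which need not lie in \<open>D\<close>. The lower bound on the Hessian keeps it inside.\<close>

lemma radius_bound:
  defines "r \<equiv> \<lambda>k. N (x k - x0)"
  shows "r k * (1 - (1 - r k) ^ 3) / 3 \<le> (major \<beta> (ts k) + \<beta>) * r k"
proof -
  define v where "v = x k - x0"
  have r: "0 \<le> r k" "r k < 1" "r k = N v"
    using N_x[of k] ts_bounds[of k] tau_lt_1 by (auto simp: r_def v_def)
  \<comment> \<open>The cubic term is an antiderivative of the negative of the lower bound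
    \<open>(1 - \<sigma> * r k)^2 * (r k)^2\<close> for the derivative of the first summand.\<close>
  let ?F = "\<lambda>\<sigma>. G (x0 + \<sigma> *\<^sub>R v) v + r k * (1 - \<sigma> * r k) ^ 3 / 3"
  have "?F 0 \<le> ?F 1"
  proof (rule DERIV_nonneg_imp_nondecreasing[of 0 1 ?F])
    fix \<sigma> :: real assume \<sigma>: "0 \<le> \<sigma>" "\<sigma> \<le> 1"
    have mem: "x0 + \<sigma> *\<^sub>R v \<in> D" using segment_in_D[OF x0 _ \<sigma>, of v] x_D[of k] by (simp add: v_def)
    have "\<sigma> * r k \<le> 1 * r k" using \<sigma> r by (intro mult_right_mono) auto
    then have "\<sigma> * r k < 1" using r by simp
    then have "(1 - \<sigma> * r k)\<^sup>2 * (r k)\<^sup>2 \<le> B (x0 + \<sigma> *\<^sub>R v) v v"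
      using hess_lower[OF mem, of "\<sigma> * r k" v] \<sigma> r by (simp add: N_scale)
    moreover have "((\<lambda>\<sigma>. r k * (1 - \<sigma> * r k) ^ 3 / 3) has_real_derivative - ((1 - \<sigma> * r k)\<^sup>2 * (r k)\<^sup>2)) (at \<sigma>)"
      by (auto intro!: derivative_eq_intros simp: power2_eq_square)
    then have "(?F has_real_derivative B (x0 + \<sigma> *\<^sub>R v) v v + - ((1 - \<sigma> * r k)\<^sup>2 * (r k)\<^sup>2)) (at \<sigma>)"
      by (intro DERIV_add G_line_deriv[OF mem])
    ultimately show "\<exists>y. (?F has_real_derivative y) (at \<sigma>) \<and> 0 \<le> y"
      by (intro exI[of _ "B (x0 + \<sigma> *\<^sub>R v) v v + - ((1 - \<sigma> * r k)\<^sup>2 * (r k)\<^sup>2)"]) simp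
  qed simp
  then have "r k * (1 - (1 - r k) ^ 3) / 3 \<le> G (x k) v - G x0 v"
    by (simp add: v_def algebra_simps diff_divide_distrib)
  also have "\<dots> \<le> major \<beta> (ts k) * r k + \<beta> * r k"
    using G_x[of k v] G_x0[of v] unfolding r(3) by linarith
  finally show ?thesis by (simp add: distrib_right)
qed

text \<open>Were the distance equal to 1 - h with h = sqrt 2 / 2, the limit of
  \<open>radius_bound\<close> would give 1 - h^3 <= 3 \<beta>. With h^3 = h/2 and \<beta> <= 3 - 4h
  this says 23h <= 16, contradicting 529/2 > 256.\<close>

lemma N_xs_less: "N (xs - x0) < 1 - 1 / sqrt 2"
proof (rule ccontr)
  define r where "r = N (xs - x0)"
  assume "\<not> ?thesis"
  then have r: "r = 1 - 1 / sqrt 2" using N_xs tau_le by (simp add: r_def)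
  define h where "h = sqrt 2 / (2 :: real)"
  have h: "h\<^sup>2 = 1 / 2" "h > 0" by (simp_all add: h_def power_divide)
  have rh: "r = 1 - h" by (simp add: r h_def real_div_sqrt field_simps)
  have "h < 1" using h by (intro power_less_imp_less_base[of h 2 1]) auto
  then have r0: "r > 0" by (simp add: rh)
  have "r * (1 - (1 - r) ^ 3) / 3 \<le> (0 + \<beta>) * r"
  proof (rule LIMSEQ_le)
    show "(\<lambda>k. N (x k - x0) * (1 - (1 - N (x k - x0)) ^ 3) / 3) \<longlonglongrightarrow> r * (1 - (1 - r) ^ 3) / 3"
      unfolding r_def by (intro tendsto_intros N_tendsto) simp
    show "(\<lambda>k. (major \<beta> (ts k) + \<beta>) * N (x k - x0)) \<longlonglongrightarrow> (0 + \<beta>) * r"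
      unfolding r_def by (intro tendsto_intros N_tendsto major_ts_tendsto)
  qed (use radius_bound in blast)
  moreover have "1 - r = h" using rh by simp
  ultimately have "r * ((1 - h ^ 3) / 3) \<le> r * \<beta>" by (simp add: mult.commute)
  then have "1 - h ^ 3 \<le> 3 * \<beta>" using r0 by simp
  moreover have "h ^ 3 = h / 2" using h(1) by (simp add: power3_eq_cube power2_eq_square)
  moreover have "\<beta> \<le> 3 - 4 * h" using b1 by (simp add: h_def)
  ultimately have "23 * h \<le> 16" by simp
  then have "(23 * h)\<^sup>2 \<le> 16\<^sup>2" using h(2) by (intro power_mono) auto
  then show False using h(1) by (simp add: power_mult_distrib)
qed

lemma xs_D: "xs \<in> D" using in_D[OF N_xs_less] .

lemma G_xs: "G xs w = 0"
proof -
  have "isCont (grad f) xs" using grad_deriv[OF xs_D] has_derivative_continuous by blast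
  then have "(\<lambda>k. grad f (x k)) \<longlonglongrightarrow> grad f xs" using isCont_tendsto_compose x_tendsto by blast
  then have "(\<lambda>k. \<bar>G (x k) w\<bar>) \<longlonglongrightarrow> \<bar>G xs w\<bar>" unfolding G_def by (intro tendsto_intros)
  moreover have "(\<lambda>k. major \<beta> (ts k) * N w) \<longlonglongrightarrow> 0 * N w" by (intro tendsto_intros major_ts_tendsto)
  ultimately have "\<bar>G xs w\<bar> \<le> 0 * N w" using G_x by (intro LIMSEQ_le) auto
  then show ?thesis by simp
qed

text \<open>A critical point minimizes \<open>f\<close> over all of \<open>D\<close>. Hence the
  midpoint between \<open>xs\<close> and a competing minimizer, where strict convexity gives a
  smaller value, need only lie in \<open>D\<close>, not in \<open>S\<close>.\<close>

lemma xs_unique_min: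
  assumes "S \<subseteq> D" "xs \<in> S"
  shows "is_arg_min f (\<lambda>w. w \<in> S) z \<longleftrightarrow> z = xs"
proof -
  have "grad f xs = 0" using G_xs[of "grad f xs"] a by (simp add: G_def)
  then have min: "f xs \<le> f w" if "w \<in> D" for w
    using gradient_inequality[OF xs_D that] by simp
  have "z = xs" if z: "is_arg_min f (\<lambda>w. w \<in> S) z"
  proof (rule ccontr)
    assume "z \<noteq> xs"
    have "z \<in> D" "f z \<le> f xs" using z assms by (auto simp: is_arg_min_def not_less)
    have "f ((1 - t) *\<^sub>R z + t *\<^sub>R xs) < (1 - t) * f z + t * f xs" if "0 < t" "t < 1" for t
      using sc \<open>z \<in> D\<close> xs_D \<open>z \<noteq> xs\<close> that unfolding self_concordant_on_def strictly_convex_on_def by blast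
    from this[of "1 / 2"] have "f ((1 - 1 / 2) *\<^sub>R z + (1 / 2) *\<^sub>R xs) < (1 - 1 / 2) * f z + 1 / 2 * f xs"
      by simp
    moreover have "(1 - 1 / 2 :: real) *\<^sub>R z + (1 / 2) *\<^sub>R xs \<in> D"
      using \<open>z \<in> D\<close> xs_D by (intro convexD_alt[OF convex_D]) auto
    ultimately show False using min \<open>f z \<le> f xs\<close> by fastforce
  qed
  moreover have "is_arg_min f (\<lambda>w. w \<in> S) xs"
    using min assms by (auto simp: is_arg_min_def not_less)
  ultimately show ?thesis by blast
qed

section \<open>Order of convergence\<close>

lemma cubic_step:
  assumes R: "N (x k - x0) \<le> R" "N (y k - x0) \<le> R" "N (xs - x0) \<le> R" "R < 1 - 1 / sqrt 2"
  defines "H \<equiv> 2 / (1 - R) ^ 3 / major_slope R" and "e \<equiv> N (xs - x k)"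
  shows "N (xs - x (Suc k)) \<le> H\<^sup>2 / 2 * (1 + H * e / 4) * e ^ 3"
proof -
  have R1: "R < 1" using R(4) by (smt (verit) divide_pos_pos real_sqrt_gt_zero)
  have sl: "major_slope R > 0" using major_slope_pos[OF R(4)] .
  have H: "H \<ge> 0" using sl R1 by (simp add: H_def)
  have e: "e \<ge> 0" by (simp add: e_def)
  define \<eta> where "\<eta> = N (xs - y k)"
  have \<eta>0: "\<eta> \<ge> 0" by (simp add: \<eta>_def)
  have step: "N (xs - q) \<le> H * ((N (p - x k) + e) / 2) * N (xs - p)"
    if p: "p \<in> D" "N (p - x0) \<le> R" and q: "\<And>w. B (x k) (q - p) w = - G p w" for p q
  proof -
    have "\<bar>B (x k) (xs - q) w\<bar> \<le> 2 / (1 - R) ^ 3 * ((N (p - x k) + e) / 2) * N (xs - p) * N w" for w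
    proof -
      interpret K: semi_inner "B (x k)" by (rule semi_inner_B[OF x_D])
      \<comment> \<open>Because \<open>G xs\<close> vanishes and \<open>q\<close> solves the Newton
        equation at \<open>p\<close>, the error after a substep is governed by the Taylor remainder
        between \<open>p\<close> and \<open>xs\<close>.\<close>
      have "B (x k) (xs - q) w = B (x k) (xs - p) w - B (x k) (q - p) w"
        by (simp flip: K.left(2))
      also have "\<dots> = - (G xs w - G p w - B (x k) (xs - p) w)" using q G_xs by simp
      finally show ?thesis
        using residual_lipschitz[OF x_D p(1) xs_D R(1) p(2) R(3) R1, of w] by (simp add: e_def)
    qed
    from newton_bound[OF x_D R(1,4) this] show ?thesis by (simp add: H_def)
  qed
  have "\<eta> \<le> H * ((N (x k - x k) + e) / 2) * N (xs - x k)"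
    unfolding \<eta>_def by (rule step[OF x_D R(1)]) (rule newton_step[OF inv y_eq])
  then have \<eta>: "\<eta> \<le> H / 2 * e\<^sup>2" by (simp add: e_def power2_eq_square)
  have "N (xs - x (Suc k)) \<le> H * ((N (y k - x k) + e) / 2) * \<eta>"
    unfolding \<eta>_def by (rule step[OF y_D R(2)]) (rule newton_step[OF inv x_Suc])
  also have "\<dots> \<le> H * ((\<eta> + e + e) / 2) * \<eta>"
    using N_triangle_diff[of "y k" "x k" xs] H \<eta>0 N_commute[of "y k" xs]
    by (intro mult_left_mono mult_right_mono divide_right_mono) (auto simp: \<eta>_def e_def)
  also have "\<dots> \<le> H * ((H / 2 * e\<^sup>2 + e + e) / 2) * (H / 2 * e\<^sup>2)"
    using \<eta> \<eta>0 H e by (intro mult_mono divide_right_mono add_mono mult_left_mono) auto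
  also have "\<dots> = H\<^sup>2 / 2 * (1 + H * e / 4) * e ^ 3"
    by (simp add: field_simps power2_eq_square power3_eq_cube)
  finally show ?thesis .
qed

lemma eventually_cubic: "\<exists>C\<ge>0. \<exists>K. \<forall>k\<ge>K. N (x (Suc k) - xs) \<le> C * N (x k - xs) ^ 3"
proof -
  define R where "R = (N (xs - x0) + (1 - 1 / sqrt 2)) / 2"
  have R: "N (xs - x0) < R" "R < 1 - 1 / sqrt 2" using N_xs_less by (auto simp: R_def)
  define H where "H = 2 / (1 - R) ^ 3 / major_slope R"
  have "R < 1" using R(2) by (smt (verit) divide_pos_pos real_sqrt_gt_zero)
  then have H: "H \<ge> 0" using major_slope_pos[OF R(2)] by (simp add: H_def)
  obtain l where l: "ts \<longlonglongrightarrow> l" using ts_convergent convergentD by blast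
  \<comment> \<open>The scalar increment dominates \<open>N (y k - x k)\<close>, so this single
    limit places both \<open>x k\<close> and \<open>y k\<close> within radius \<open>R\<close>
    eventually.\<close>
  have "(\<lambda>k. (ts (Suc k) - ts k) + N (x k - x0)) \<longlonglongrightarrow> (l - l) + N (xs - x0)"
    by (intro tendsto_intros N_tendsto l LIMSEQ_Suc[OF l])
  then have "\<forall>\<^sub>F k in sequentially. (ts (Suc k) - ts k) + N (x k - x0) < R"
    using R(1) by (intro order_tendstoD(2)) auto
  moreover have "\<forall>\<^sub>F k in sequentially. N (x k - xs) < 1"
    using error_tendsto by (rule order_tendstoD(2)) simp
  ultimately have "\<forall>\<^sub>F k in sequentially. N (x (Suc k) - xs) \<le> H\<^sup>2 / 2 * (1 + H / 4) * N (x k - xs) ^ 3"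
  proof eventually_elim
    case (elim k)
    have 1: "N (x k - x0) \<le> R" using elim ts_incseq by (smt (verit) incseq_SucD)
    have 2: "N (y k - x0) \<le> R"
      using N_triangle_diff[of "y k" x0 "x k"] N_yx[of k] ts_step[of k] elim by linarith
    have "N (xs - x (Suc k)) \<le> H\<^sup>2 / 2 * (1 + H * N (xs - x k) / 4) * N (xs - x k) ^ 3"
      unfolding H_def using cubic_step[OF 1 2] R by simp
    also have "\<dots> \<le> H\<^sup>2 / 2 * (1 + H / 4) * N (xs - x k) ^ 3"
      using elim(2) H N_commute[of "x k" xs]
      by (intro mult_right_mono mult_left_mono add_left_mono divide_right_mono) (auto simp: mult_left_le)
    finally show ?case by (simp add: N_commute[of _ xs])
  qed
  then show ?thesis using H unfolding eventually_sequentially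
    by (intro exI[of _ "H\<^sup>2 / 2 * (1 + H / 4)"]) auto
qed

text \<open>One factor of the error in the cubic estimate tends to 0 and absorbs any
  constant.\<close>

lemma Q_superquadratic: "converges_Q_superquadratically N x xs"
proof -
  obtain C K where C: "C \<ge> 0" "\<And>k. k \<ge> K \<Longrightarrow> N (x (Suc k) - xs) \<le> C * N (x k - xs) ^ 3"
    using eventually_cubic by blast
  have "\<exists>K. \<forall>k\<ge>K. N (x (Suc k) - xs) \<le> c * N (x k - xs) ^ 2" if "c > 0" for c
  proof -
    have "(\<lambda>k. C * N (x k - xs)) \<longlonglongrightarrow> C * 0" by (intro tendsto_intros error_tendsto)
    then have "\<forall>\<^sub>F k in sequentially. C * N (x k - xs) < c" using that by (intro order_tendstoD(2)) auto
    then obtain K' where K': "\<And>k. k \<ge> K' \<Longrightarrow> C * N (x k - xs) < c" by (auto simp: eventually_sequentially)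
    have "N (x (Suc k) - xs) \<le> c * N (x k - xs) ^ 2" if "k \<ge> max K K'" for k
    proof -
      have "N (x (Suc k) - xs) \<le> C * N (x k - xs) * N (x k - xs) ^ 2"
        using C(2)[of k] that by (simp add: power2_eq_square power3_eq_cube mult.assoc)
      also have "\<dots> \<le> c * N (x k - xs) ^ 2" using K'[of k] that by (intro mult_right_mono) auto
      finally show ?thesis .
    qed
    then show ?thesis by blast
  qed
  then show ?thesis using error_tendsto by (simp add: converges_Q_superquadratically_def)
qed

lemma Q_cubic: "converges_Q_cubically N x xs"
  using error_tendsto eventually_cubic by (simp add: converges_Q_cubically_def)

lemma cubic_error_bound:
  assumes "0 < \<beta>" "\<beta> < 3 - root 3 2 - root 3 4"
  shows "N (xs - x (Suc k)) \<le> q_const \<beta> * (H_star \<beta>)\<^sup>2 / 2 * N (xs - x k) ^ 3"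
proof -
  define H where "H = 2 / (1 - \<tau>) ^ 3 / major_slope \<tau>"
  define e where "e = N (xs - x k)"
  have "major_slope \<tau> > 0" using major_slope_pos tau_lt_r0[OF assms] by blast
  then have H: "H \<ge> 0" using tau_lt_1 by (simp add: H_def)
  have "N (x k - x0) \<le> \<tau>" "N (y k - x0) \<le> \<tau>"
    using N_x[of k] N_y[of k] ts_bounds[of k] ss_bounds[of k] by auto
  then have "N (xs - x (Suc k)) \<le> H\<^sup>2 / 2 * (1 + H * e / 4) * e ^ 3"
    unfolding H_def e_def using cubic_step N_xs tau_lt_r0[OF assms] by blast
  also have "\<dots> \<le> H\<^sup>2 / 2 * q_const \<beta> * e ^ 3"
  proof (intro mult_right_mono mult_left_mono)
    have "e \<le> 2 * \<tau>"
      using N_triangle_diff[of xs "x k" x0] N_xs \<open>N (x k - x0) \<le> \<tau>\<close> N_commute[of x0 "x k"] by (simp add: e_def)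
    then have "H * e \<le> H * (2 * \<tau>)" using H by (rule mult_left_mono)
    then show "1 + H * e / 4 \<le> q_const \<beta>"
      using q_const_ge[OF assms, folded H_def] by simp
  qed (auto simp: e_def)
  also have "H\<^sup>2 = (H_star \<beta>)\<^sup>2" using H_star_eq[OF assms] by (simp add: H_def)
  finally show ?thesis by (simp add: e_def mult_ac)
qed

end

theorem corollary3p4:
  fixes f :: "real ^ 'n \<Rightarrow> real" and D :: "(real ^ 'n) set"
    and a \<beta> :: real and x0 :: "real ^ 'n" and x y :: "nat \<Rightarrow> real ^ 'n"
  assumes "0 < a" and "open D" and "convex D"
    and "self_concordant_on a D f"
    and "x0 \<in> D" and "invertible (hess f x0)"
    and "local_ball a f x0 (1 - 1 / sqrt 2) \<subseteq> D"
    and "x 0 = x0"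
    and "\<And>k. y k = x k - matrix_inv (hess f (x k)) *v grad f (x k)"
    and "\<And>k. x (Suc k) = y k - matrix_inv (hess f (x k)) *v grad f (y k)"
    and "\<beta> = local_norm a f x0 (matrix_inv (hess f x0) *v grad f x0)"
    and "\<beta> \<le> 3 - 2 * sqrt 2"
  shows "(\<forall>k. x k \<in> D \<and> invertible (hess f (x k)) \<and> y k \<in> D) \<and>
    (\<exists>xs\<in>D.
       converges_Q_superquadratically (local_norm a f x0) x xs \<and>
       (\<forall>z. is_arg_min f (\<lambda>w. w \<in> local_cball a f x0 (t_star \<beta>) \<inter> D) z \<longleftrightarrow> z = xs) \<and>
       (\<forall>r. t_star \<beta> \<le> r \<and> r < t_star_star \<beta> \<longrightarrow>
          (\<forall>z. is_arg_min f (\<lambda>w. w \<in> local_cball a f x0 r \<inter> D) z \<longleftrightarrow> z = xs)) \<and>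
       (0 < \<beta> \<and> \<beta> < 3 - root 3 2 - root 3 4 \<longrightarrow>
          converges_Q_cubically (local_norm a f x0) x xs \<and>
          (\<forall>k. local_norm a f x0 (xs - x (Suc k))
             \<le> q_const \<beta> * H_star \<beta> ^ 2 / 2 * local_norm a f x0 (xs - x k) ^ 3)))"
proof -
  interpret self_concordant_at f a D x0
    using assms by unfold_locales auto
  interpret two_step_newton f a D x0 \<beta> x y
  proof
    show "0 \<le> \<beta>" using assms(11) by (simp add: local_norm_eq_N)
  qed (use assms in \<open>auto simp: local_norm_eq_N\<close>)
  \<comment> \<open>Both minimizer claims are instances: such a ball contains \<open>xs\<close>,
    which minimizes \<open>f\<close> over \<open>D\<close>.\<close>
  have arg_min: "is_arg_min f (\<lambda>w. w \<in> local_cball a f x0 r \<inter> D) z \<longleftrightarrow> z = xs" if "t_star \<beta> \<le> r" for r z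
    using N_xs xs_D that by (intro xs_unique_min) (auto simp: local_cball_def local_norm_eq_N \<tau>_def)
  show ?thesis
    unfolding local_norm_eq_N
    using x_D inv y_D xs_D Q_superquadratic arg_min Q_cubic cubic_error_bound by blast
qed

end
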